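(* Let $\sigma$ be any fixed signature containing at least two labels. For any $\epsilon>0$, there is an infinite family $G_1,G_2,\ldots$ of labelled two-way path ($\mathsf{2WP}$) queries and an infinite family $H_1,H_2,\ldots$ of labelled downward tree ($\mathsf{DWT}$) instances, all on signature $\sigma$ and with $\|G_i\|+\|H_i\|$ unbounded, such that, for any $i>0$, any DNNF circuit representing the Boolean function $\mathsf{Prov}^{G_i}_{H_i}$ has size at least $2^{\Omega\left((\|G_i\|+\|H_i\|)^{1-\epsilon}\right)}$ (the constant in $\Omega$ being independent of $i$).
   Context: A signature $\sigma$ is a non-empty finite set of labels. A graph over $\sigma$ is $G=(V,E,\lambda)$ with $V$ finite non-empty, $E\subseteq V^2$ (directed edges), $\lambda:E\to\sigma$; its size $\|G\|$ is $|E|$. A homomorphism from $G$ to $H$ is a map $h:V_G\to V_H$ such that for all $(u,v)\in E_G$ we have $(h(u),h(v))\in E_H$ and $\lambda_H((h(u),h(v)))=\lambda_G((u,v))$; write $G\rightsquigarrow H$ if one exists. A two-way path is a graph $a_1 - \cdots - a_m$ with pairwise distinct $a_i$, each $-$ being one labelled edge in one of the two directions. A downward tree is a rooted unranked tree with all edges directed from parent to child. Provenance: for graphs $G,H$, $\mathsf{Prov}^G_H$ is the Boolean function whose variables are the edges $E_H$ of $H$, mapping a valuation $\nu:E_H\to\{0,1\}$ to $1$ iff $G\rightsquigarrow H_\nu$, where $H_\nu$ is the subgraph of $H$ on the same vertices keeping exactly the edges $e$ with $\nu(e)=1$. A circuit on a set of Boolean variables is a directed acyclic graph of gates (edges are called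 wires) with a distinguished output gate, where gates are labelled by variables (no inputs), or by $\lor$, $\land$, $\neg$ ($\neg$-gates having exactly one input); it computes a Boolean function in the usual way. It is a DNNF if negations are applied only to variable gates and it is decomposable: no $\land$-gate has two distinct inputs $g_1,g_2$ such that some variable labels two variable gates $g_1',g_2'$ with a directed path from $g_1'$ to $g_1$ and from $g_2'$ to $g_2$. The size of a circuit is its number of wires. *)

theory Defs
  imports Complex_Main
begin

text \<open>
  Values of \<open>lab\<close> outside the edge set are irrelevant: every notion below inspects \<open>lab\<close>
  on edges only.
\<close>

record ('v, 's) lgraph =
  verts :: "'v set"
  edges :: "('v \<times> 'v) set"
  lab :: "'v \<times> 'v \<Rightarrow> 's"

definition graph_over :: "'s set \<Rightarrow> ('v, 's) lgraph \<Rightarrow> bool" where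
  "graph_over \<sigma> G \<longleftrightarrow>
     finite (verts G) \<and> verts G \<noteq> {} \<and> edges G \<subseteq> verts G \<times> verts G \<and> lab G ` edges G \<subseteq> \<sigma>"

definition graph_size :: "('v, 's) lgraph \<Rightarrow> nat" where
  "graph_size G = card (edges G)"

definition is_hom :: "('v, 's) lgraph \<Rightarrow> ('w, 's) lgraph \<Rightarrow> ('v \<Rightarrow> 'w) \<Rightarrow> bool" where
  "is_hom G H h \<longleftrightarrow>
     h ` verts G \<subseteq> verts H \<and>
     (\<forall>u v. (u, v) \<in> edges G \<longrightarrow> (h u, h v) \<in> edges H \<and> lab H (h u, h v) = lab G (u, v))"

definition has_hom :: "('v, 's) lgraph \<Rightarrow> ('w, 's) lgraph \<Rightarrow> bool"  (infix "\<leadsto>" 50) where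
  "G \<leadsto> H \<longleftrightarrow> (\<exists>h. is_hom G H h)"

text \<open>
  The function \<open>fwd\<close> chooses, for each pair of consecutive vertices, the direction of the one
  edge between them. Paths consisting of a single vertex are allowed.
\<close>

definition two_way_path :: "('v, 's) lgraph \<Rightarrow> bool" where
  "two_way_path G \<longleftrightarrow>
     (\<exists>as fwd. as \<noteq> [] \<and> distinct as \<and> verts G = set as \<and>
        edges G = {if fwd i then (as ! i, as ! Suc i) else (as ! Suc i, as ! i) | i. Suc i < length as})"

definition downward_tree :: "('v, 's) lgraph \<Rightarrow> bool" where
  "downward_tree G \<longleftrightarrow>
     (\<exists>r \<in> verts G.
        (\<forall>u. (u, r) \<notin> edges G) \<and>
        (\<forall>v \<in> verts G - {r}. \<exists>!u. (u, v) \<in> edges G) \<and>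
        (\<forall>v \<in> verts G. (r, v) \<in> (edges G)\<^sup>*))"

text \<open>
  Valuations are total functions on the type of potential edges; only their restriction to
  \<open>edges H\<close> matters for \<open>restrict_graph H \<nu>\<close> and hence for \<open>Prov G H\<close>.
\<close>

definition restrict_graph :: "('v, 's) lgraph \<Rightarrow> ('v \<times> 'v \<Rightarrow> bool) \<Rightarrow> ('v, 's) lgraph" where
  "restrict_graph H \<nu> = H\<lparr>edges := {e \<in> edges H. \<nu> e}\<rparr>"

definition Prov :: "('v, 's) lgraph \<Rightarrow> ('w, 's) lgraph \<Rightarrow> ('w \<times> 'w \<Rightarrow> bool) \<Rightarrow> bool" where
  "Prov G H \<nu> \<longleftrightarrow> G \<leadsto> restrict_graph H \<nu>"

datatype 'x gate_label = Var 'x | Or | And | Not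

text \<open>A wire \<open>(g', g)\<close> makes \<open>g'\<close> an input of \<open>g\<close>.\<close>

record ('g, 'x) circuit =
  gates :: "'g set"
  wires :: "('g \<times> 'g) set"
  out_gate :: 'g
  glabel :: "'g \<Rightarrow> 'x gate_label"

definition inputs :: "('g, 'x) circuit \<Rightarrow> 'g \<Rightarrow> 'g set" where
  "inputs C g = {g'. (g', g) \<in> wires C}"

text \<open>
  Disjunction and conjunction gates have arbitrary fan-in, possibly zero (the constants false
  and true). A variable may label several gates.
\<close>

definition circuit_on :: "'x set \<Rightarrow> ('g, 'x) circuit \<Rightarrow> bool" where
  "circuit_on X C \<longleftrightarrow>
     finite (gates C) \<and> wires C \<subseteq> gates C \<times> gates C \<and> acyclic (wires C) \<and> out_gate C \<in> gates C \<and>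
     (\<forall>g \<in> gates C. \<forall>x. glabel C g = Var x \<longrightarrow> x \<in> X \<and> inputs C g = {}) \<and>
     (\<forall>g \<in> gates C. glabel C g = Not \<longrightarrow> card (inputs C g) = 1)"

definition circuit_size :: "('g, 'x) circuit \<Rightarrow> nat" where
  "circuit_size C = card (wires C)"

definition gate_value :: "('g, 'x) circuit \<Rightarrow> ('x \<Rightarrow> bool) \<Rightarrow> 'g \<Rightarrow> bool" where
  "gate_value C \<nu> = wfrec (wires C)
     (\<lambda>val g. case glabel C g of
        Var x \<Rightarrow> \<nu> x
      | Or \<Rightarrow> (\<exists>g' \<in> inputs C g. val g')
      | And \<Rightarrow> (\<forall>g' \<in> inputs C g. val g')
      | Not \<Rightarrow> (\<exists>g' \<in> inputs C g. \<not> val g'))"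

lemma gate_value_rec:
  assumes "circuit_on X C"
  shows "gate_value C \<nu> g \<longleftrightarrow>
    (case glabel C g of
       Var x \<Rightarrow> \<nu> x
     | Or \<Rightarrow> (\<exists>g' \<in> inputs C g. gate_value C \<nu> g')
     | And \<Rightarrow> (\<forall>g' \<in> inputs C g. gate_value C \<nu> g')
     | Not \<Rightarrow> (\<exists>g' \<in> inputs C g. \<not> gate_value C \<nu> g'))"
proof -
  have "finite (wires C)" "acyclic (wires C)"
    using assms finite_subset unfolding circuit_on_def by blast+
  then have wf: "wf (wires C)"
    by (rule finite_acyclic_wf)
  show ?thesis
    unfolding gate_value_def
    by (subst wfrec[OF wf]) (auto simp: inputs_def cut_apply split: gate_label.splits)
qed

definition circuit_computes :: "('g, 'x) circuit \<Rightarrow> (('x \<Rightarrow> bool) \<Rightarrow> bool) \<Rightarrow> bool" where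
  "circuit_computes C f \<longleftrightarrow> (\<forall>\<nu>. gate_value C \<nu> (out_gate C) = f \<nu>)"

definition negations_on_variables :: "('g, 'x) circuit \<Rightarrow> bool" where
  "negations_on_variables C \<longleftrightarrow>
     (\<forall>g \<in> gates C. glabel C g = Not \<longrightarrow> (\<forall>g' \<in> inputs C g. \<exists>x. glabel C g' = Var x))"

text \<open>
  The variable gates \<open>v1\<close> and \<open>v2\<close> may coincide, and the directed paths may be empty.
\<close>

definition decomposable :: "('g, 'x) circuit \<Rightarrow> bool" where
  "decomposable C \<longleftrightarrow>
     (\<forall>g \<in> gates C. glabel C g = And \<longrightarrow>
        \<not> (\<exists>g1 \<in> inputs C g. \<exists>g2 \<in> inputs C g. g1 \<noteq> g2 \<and>
             (\<exists>x. \<exists>v1 \<in> gates C. \<exists>v2 \<in> gates C.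
                glabel C v1 = Var x \<and> glabel C v2 = Var x \<and>
                (v1, g1) \<in> (wires C)\<^sup>* \<and> (v2, g2) \<in> (wires C)\<^sup>*)))"

definition DNNF :: "'x set \<Rightarrow> ('g, 'x) circuit \<Rightarrow> bool" where
  "DNNF X C \<longleftrightarrow> circuit_on X C \<and> negations_on_variables C \<and> decomposable C"

end

theory Submission
  imports Defs "HOL-Library.FuncSet" "HOL-Library.Countable" "HOL-Real_Asymp.Real_Asymp"
begin

text \<open>
  The provenance of the query on the instance encodes the monotone CNF stating that a set of
  vertices of the \<open>d\<close>-dimensional hypercube is a vertex cover. Below its root, the tree has one
  edge per vertex \<open>w\<close>; below that edge, each clause containing \<open>w\<close> is spelled out in binary on a
  path of its own. The query spells the clauses one after the other, each time going down
  the full height of the tree and back up, so that every descent has to start at the root and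
  has to choose a vertex of the clause. Binary codes cost only a factor \<open>O(d)\<close>, so that the total
  size is \<open>2^d\<close> up to a polynomial in \<open>d\<close>.

  A DNNF with \<open>s\<close> wires covers the function by \<open>s\<close> combinatorial rectangles whose
  partitions are balanced on the hypercube vertices. By edge isoperimetry many edges are cut; a
  rectangle contained in the function must, for each cut edge, set one endpoint to true
  throughout. Hence it fixes many vertices, and among them many with disjoint
  neighbourhoods. The complement of a sparse random independent set is a vertex cover that
  contains all of these with exponentially small probability only, so \<open>s\<close> is exponential.
\<close>

subsection \<open>Isoperimetry of the hypercube\<close>

definition closed_nbhd :: "('a \<times> 'a) set \<Rightarrow> 'a \<Rightarrow> 'a set" where
  "closed_nbhd E v = insert v {u. (u, v) \<in> E \<or> (v, u) \<in> E}"

definition cut_edges :: "('a \<times> 'a) set \<Rightarrow> 'a set \<Rightarrow> ('a \<times> 'a) set" where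
  "cut_edges E A = {(u, v) \<in> E. (u \<in> A) \<noteq> (v \<in> A)}"

text \<open>The hypercube on bit strings read as numbers below \<open>2 ^ d\<close>: adding
  \<open>2 ^ d\<close> sets the new top bit, which gives a second copy and a perfect matching
  between the copies. Every edge is listed once, smaller end first.\<close>

fun cube :: "nat \<Rightarrow> (nat \<times> nat) set" where
  "cube 0 = {}"
| "cube (Suc d) = cube d \<union> map_prod ((+) (2 ^ d)) ((+) (2 ^ d)) ` cube d
     \<union> (\<lambda>u. (u, 2 ^ d + u)) ` {..<2 ^ d}"

lemma cube_bounds:
  assumes "(u, v) \<in> cube d"
  shows "u < v" "v < 2 ^ d"
  using assms by (induction d arbitrary: u v) force+

lemma cube_subset: "cube d \<subseteq> {..<2 ^ d} \<times> {..<2 ^ d}"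
  using cube_bounds by (fastforce dest: less_trans)

lemma finite_cube: "finite (cube d)"
  by (induction d) auto

lemma card_cube_le: "card (cube d) \<le> d * 2 ^ d"
proof (induction d)
  case (Suc d)
  have "card (cube (Suc d)) \<le> card (cube d) + card (cube d) + card {..<(2::nat) ^ d}"
    unfolding cube.simps
    by (intro card_Un_le[THEN order_trans] add_mono card_image_le finite_cube) auto
  also have "\<dots> \<le> d * 2 ^ d + d * 2 ^ d + 2 ^ d"
    using Suc by simp
  also have "\<dots> \<le> Suc d * 2 ^ Suc d"
    by simp
  finally show ?case .
qed simp

lemma closed_nbhd_cube_Suc_low:
  assumes "v < 2 ^ d"
  shows "closed_nbhd (cube (Suc d)) v \<subseteq> insert (2 ^ d + v) (closed_nbhd (cube d) v)"
  using assms by (auto simp: closed_nbhd_def dest: cube_bounds)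

lemma closed_nbhd_cube_Suc_high:
  "closed_nbhd (cube (Suc d)) (2 ^ d + v) \<subseteq> insert v ((+) (2 ^ d) ` closed_nbhd (cube d) v)"
proof -
  have "(2 ^ d + v, x) \<notin> cube d" "(x, 2 ^ d + v) \<notin> cube d" for x
    using cube_bounds[of "2 ^ d + v" x d] cube_bounds[of x "2 ^ d + v" d] by auto
  then show ?thesis
    by (auto simp: closed_nbhd_def dest: cube_bounds)
qed

lemma finite_closed_nbhd: "finite E \<Longrightarrow> finite (closed_nbhd E v)"
proof -
  assume "finite E"
  moreover have "closed_nbhd E v \<subseteq> insert v (fst ` E \<union> snd ` E)"
    by (force simp: closed_nbhd_def)
  ultimately show ?thesis
    by (meson finite_UnI finite_imageI finite_insert finite_subset)
qed

text \<open>Each further dimension adds only the matching partner in the other half to a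
  neighbourhood.\<close>

lemma card_closed_nbhd_cube: "v < 2 ^ d \<Longrightarrow> card (closed_nbhd (cube d) v) \<le> Suc d"
proof (induction d arbitrary: v)
  case 0
  then show ?case by (simp add: closed_nbhd_def)
next
  case (Suc d)
  show ?case
  proof (cases "v < 2 ^ d")
    case True
    have "card (closed_nbhd (cube (Suc d)) v) \<le> card (insert (2 ^ d + v) (closed_nbhd (cube d) v))"
      using closed_nbhd_cube_Suc_low[OF True] finite_closed_nbhd[OF finite_cube]
      by (intro card_mono) auto
    also have "\<dots> \<le> Suc (card (closed_nbhd (cube d) v))"
      by (rule card_insert_le_m1) auto
    finally show ?thesis
      using Suc.IH[OF True] by linarith
  next
    case False
    then obtain w where w: "v = 2 ^ d + w"
      by (auto simp: not_less le_iff_add)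
    with Suc.prems have "w < 2 ^ d" by simp
    have "card (closed_nbhd (cube (Suc d)) v) \<le> card (insert w ((+) (2 ^ d) ` closed_nbhd (cube d) w))"
      using closed_nbhd_cube_Suc_high finite_closed_nbhd[OF finite_cube]
      unfolding w by (intro card_mono) auto
    also have "\<dots> \<le> Suc (card ((+) (2 ^ d) ` closed_nbhd (cube d) w))"
      by (rule card_insert_le_m1) auto
    also have "\<dots> = Suc (card (closed_nbhd (cube d) w))"
      by (simp add: card_image)
    finally show ?thesis
      using Suc.IH[OF \<open>w < 2 ^ d\<close>] by linarith
  qed
qed

lemma cube_neighbour_exists:
  assumes "v < 2 ^ d" "d > 0"
  obtains u where "(u, v) \<in> cube d \<or> (v, u) \<in> cube d"
proof -
  obtain k where d: "d = Suc k"
    using assms(2) gr0_conv_Suc by auto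
  show ?thesis
  proof (cases "v < 2 ^ k")
    case True
    then show ?thesis using that[of "2 ^ k + v"] by (auto simp: d)
  next
    case False
    then obtain w where "v = 2 ^ k + w"
      by (auto simp: not_less le_iff_add)
    then show ?thesis using that[of w] assms(1) by (auto simp: d)
  qed
qed

lemma card_split_pow2:
  "card ({..<(2::nat) ^ Suc d} \<inter> A) = card ({..<2 ^ d} \<inter> A) + card ({..<2 ^ d} \<inter> (+) (2 ^ d) -` A)"
proof -
  have "{..<2 ^ Suc d} \<inter> A = ({..<2 ^ d} \<inter> A) \<union> (+) (2 ^ d) ` ({..<2 ^ d} \<inter> (+) (2 ^ d) -` A)"
    (is "?L = ?R")
  proof
    show "?L \<subseteq> ?R"
    proof
      fix x assume x: "x \<in> ?L"
      show "x \<in> ?R"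
      proof (cases "x < 2 ^ d")
        case False
        then obtain w where "x = 2 ^ d + w"
          by (auto simp: not_less le_iff_add)
        with x show ?thesis by auto
      qed (use x in auto)
    qed
  qed auto
  moreover have "({..<2 ^ d} \<inter> A) \<inter> (+) (2 ^ d) ` ({..<2 ^ d} \<inter> (+) (2 ^ d) -` A) = {}"
    by auto
  ultimately show ?thesis
    by (simp only: card_Un_disjoint finite_Int finite_lessThan finite_imageI simp_thms)
      (simp add: card_image)
qed

lemma cut_edges_Un: "cut_edges (E \<union> F) A = cut_edges E A \<union> cut_edges F A"
  by (auto simp: cut_edges_def)

lemma cut_edges_map_prod: "cut_edges (map_prod f f ` E) A = map_prod f f ` cut_edges E (f -` A)"
  unfolding cut_edges_def by auto

lemma cut_edges_graph:
  "cut_edges ((\<lambda>u. (u, f u)) ` S) A = (\<lambda>u. (u, f u)) ` {u \<in> S. (u \<in> A) \<noteq> (u \<in> f -` A)}"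
  unfolding cut_edges_def by auto

text \<open>Induction on the dimension. Let \<open>a\<close> and \<open>b\<close> be the shares of
  the set in the two halves. The matching contributes at least the difference of \<open>a\<close>
  and \<open>b\<close>. If the set is a minority in both halves, or a majority in both, the two
  inductive bounds already suffice. Otherwise, say with \<open>a\<close> the smaller share, the
  three terms add up to at least \<open>a + (2 ^ d - b) + (b - a) = 2 ^ d\<close>, half of all
  vertices.\<close>

lemma cube_edge_isoperimetry:
  "min (card ({..<2 ^ d} \<inter> A)) (card ({..<2 ^ d} \<inter> - A)) \<le> card (cut_edges (cube d) A)"
proof (induction d arbitrary: A)
  case 0
  show ?case
    by (cases "0 \<in> A") (simp_all add: lessThan_Suc)
next
  case (Suc d)
  let ?V = "{..<(2::nat) ^ d}"
  define B where "B = (+) (2 ^ d) -` A"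
  define X where "X = map_prod ((+) (2 ^ d)) ((+) (2 ^ d)) ` cut_edges (cube d) B"
  define M where "M = (\<lambda>u. (u, 2 ^ d + u)) ` {u \<in> ?V. (u \<in> A) \<noteq> (u \<in> B)}"
  have eq: "cut_edges (cube (Suc d)) A = cut_edges (cube d) A \<union> X \<union> M"
    unfolding cube.simps cut_edges_Un X_def M_def B_def
    by (simp add: cut_edges_map_prod cut_edges_graph)
  have fin: "finite (cut_edges (cube d) A)" "finite X" "finite M"
    using finite_cube[of d] unfolding X_def M_def cut_edges_def
    by (auto intro: finite_subset[of _ "cube d"])
  have "cut_edges (cube d) A \<inter> X = {}" "(cut_edges (cube d) A \<union> X) \<inter> M = {}"
    by (auto simp: cut_edges_def X_def M_def dest: cube_bounds)
  then have "card (cut_edges (cube (Suc d)) A) = card (cut_edges (cube d) A) + card X + card M"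
    using fin unfolding eq by (simp add: card_Un_disjoint)
  also have "card X = card (cut_edges (cube d) B)"
    unfolding X_def by (intro card_image) (auto simp: inj_on_def)
  also have "card M = card {u \<in> ?V. (u \<in> A) \<noteq> (u \<in> B)}"
    unfolding M_def by (intro card_image) (auto simp: inj_on_def)
  finally have cut: "card (cut_edges (cube (Suc d)) A) = card (cut_edges (cube d) A)
    + card (cut_edges (cube d) B) + card {u \<in> ?V. (u \<in> A) \<noteq> (u \<in> B)}" .
  have diff: "card (?V \<inter> P) \<le> card (?V \<inter> Q) + card {u \<in> ?V. (u \<in> P) \<noteq> (u \<in> Q)}" for P Q
  proof -
    have "card (?V \<inter> P) \<le> card ((?V \<inter> Q) \<union> {u \<in> ?V. (u \<in> P) \<noteq> (u \<in> Q)})"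
      by (intro card_mono) auto
    also have "\<dots> \<le> card (?V \<inter> Q) + card {u \<in> ?V. (u \<in> P) \<noteq> (u \<in> Q)}"
      by (rule card_Un_le)
    finally show ?thesis .
  qed
  have compl: "card (?V \<inter> P) + card (?V \<inter> - P) = 2 ^ d" for P
  proof -
    have "card (?V \<inter> P) + card (?V \<inter> - P) = card ((?V \<inter> P) \<union> (?V \<inter> - P))"
      by (subst card_Un_disjoint) auto
    also have "(?V \<inter> P) \<union> (?V \<inter> - P) = ?V" by auto
    finally show ?thesis by simp
  qed
  have sym: "{u \<in> ?V. (u \<in> B) \<noteq> (u \<in> A)} = {u \<in> ?V. (u \<in> A) \<noteq> (u \<in> B)}"
    by auto
  have "card ({..<2 ^ Suc d} \<inter> - A) = card (?V \<inter> - A) + card (?V \<inter> - B)"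
    unfolding card_split_pow2 B_def by (simp add: vimage_Compl)
  moreover have "card ({..<2 ^ Suc d} \<inter> A) = card (?V \<inter> A) + card (?V \<inter> B)"
    unfolding card_split_pow2 B_def ..
  ultimately show ?case
    using Suc.IH[of A] Suc.IH[of B] diff[of A B] diff[of B A] compl[of A] compl[of B]
    unfolding cut sym by linarith
qed

subsection \<open>Rectangle covers from DNNF circuits\<close>

definition gate_vars :: "('g, 'x) circuit \<Rightarrow> 'g \<Rightarrow> 'x set" where
  "gate_vars C g = {x. \<exists>v \<in> gates C. glabel C v = Var x \<and> (v, g) \<in> (wires C)\<^sup>*}"

text \<open>
  Some downward path from the output to the gate has only true siblings at its conjunctions. By
  decomposability this does not depend on the variables below the gate
  (\<open>path_context_cong\<close>), which is what makes the sets \<open>wire_rect\<close> below rectangles.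
\<close>

inductive path_context :: "('g, 'x) circuit \<Rightarrow> ('x \<Rightarrow> bool) \<Rightarrow> 'g \<Rightarrow> bool" for C \<nu> where
  out: "path_context C \<nu> (out_gate C)"
| Or: "path_context C \<nu> g \<Longrightarrow> glabel C g = Or \<Longrightarrow> g' \<in> inputs C g \<Longrightarrow> path_context C \<nu> g'"
| And: "path_context C \<nu> g \<Longrightarrow> glabel C g = And \<Longrightarrow> g' \<in> inputs C g \<Longrightarrow>
    (\<And>h. h \<in> inputs C g \<Longrightarrow> h \<noteq> g' \<Longrightarrow> gate_value C \<nu> h) \<Longrightarrow> path_context C \<nu> g'"

lemma gate_vars_input:
  assumes "h \<in> inputs C g"
  shows "gate_vars C h \<subseteq> gate_vars C g"
  using assms unfolding gate_vars_def inputs_def by (blast intro: rtrancl_into_rtrancl)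

lemma gate_vars_Var:
  "g \<in> gates C \<Longrightarrow> glabel C g = Var x \<Longrightarrow> x \<in> gate_vars C g"
  unfolding gate_vars_def by blast

lemma gate_vars_cases:
  assumes "x \<in> gate_vars C g"
  shows "glabel C g = Var x \<or> (\<exists>h \<in> inputs C g. x \<in> gate_vars C h)"
proof -
  obtain v where v: "v \<in> gates C" "glabel C v = Var x" "(v, g) \<in> (wires C)\<^sup>*"
    using assms unfolding gate_vars_def by blast
  from v(3) show ?thesis
    by (cases rule: rtranclE) (use v in \<open>auto simp: gate_vars_def inputs_def\<close>)
qed

lemma inputs_gates:
  assumes "circuit_on X C" "h \<in> inputs C g"
  shows "h \<in> gates C" "g \<in> gates C"
  using assms unfolding circuit_on_def inputs_def by blast+

lemma wf_wires:
  assumes "circuit_on X C"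
  shows "wf (wires C)"
proof -
  have "finite (wires C)" "acyclic (wires C)"
    using assms finite_subset unfolding circuit_on_def by blast+
  then show ?thesis
    by (rule finite_acyclic_wf)
qed

lemma decomposable_disjoint:
  assumes "circuit_on X C" "decomposable C" "glabel C g = And"
    and "h \<in> inputs C g" "h' \<in> inputs C g" "h \<noteq> h'"
  shows "gate_vars C h \<inter> gate_vars C h' = {}"
  using assms inputs_gates(2)[OF assms(1,4)]
  unfolding decomposable_def gate_vars_def by blast

lemma gate_value_cong:
  assumes C: "circuit_on X C"
    and "g \<in> gates C" "\<And>x. x \<in> gate_vars C g \<Longrightarrow> \<nu> x = \<mu> x"
  shows "gate_value C \<nu> g = gate_value C \<mu> g"
  using assms(2,3)
proof (induction g rule: wf_induct_rule[OF wf_wires[OF C]])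
  case (1 g)
  have IH: "gate_value C \<nu> h = gate_value C \<mu> h" if "h \<in> inputs C g" for h
    using that 1 gate_vars_input[OF that] inputs_gates[OF C that]
    by (auto simp: inputs_def)
  show ?case
    using IH 1(2,3) gate_vars_Var[of g C]
    by (auto simp: gate_value_rec[OF C, of _ g] split: gate_label.split)
qed

lemma path_context_gates:
  assumes "circuit_on X C" "path_context C \<nu> g"
  shows "g \<in> gates C"
  using assms(2,1) by induction (auto simp: circuit_on_def inputs_def)

text \<open>Truth climbs the path: at a disjunction one true input suffices, and at a conjunction
  all siblings are true already.\<close>

lemma path_context_sound:
  assumes C: "circuit_on X C" and "path_context C \<nu> g" "gate_value C \<nu> g"
  shows "gate_value C \<nu> (out_gate C)"
  using assms(2,3)
proof induction
  case (Or g g')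
  then show ?case by (auto simp: gate_value_rec[OF C, of _ g])
next
  case (And g g')
  have "gate_value C \<nu> g"
    unfolding gate_value_rec[OF C, of _ g] using And by auto
  then show ?case by (rule And.IH)
qed

text \<open>By decomposability, a sibling at a conjunction shares no variable with the input on the
  path, hence none with any gate further down, so its value survives the change of
  valuation.\<close>

lemma path_context_cong:
  assumes C: "circuit_on X C" and dec: "decomposable C"
    and "path_context C \<nu> g" "\<And>x. x \<notin> gate_vars C g \<Longrightarrow> \<nu> x = \<mu> x"
  shows "path_context C \<mu> g"
  using assms(3,4)
proof induction
  case out
  show ?case by (rule path_context.out)
next
  case (Or g g')
  have "path_context C \<mu> g"
    using Or.IH Or.prems gate_vars_input[OF Or.hyps(3)] by blast
  then show ?case using Or.hyps(2,3) by (rule path_context.Or)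
next
  case (And g g')
  have "path_context C \<mu> g"
    using And.IH And.prems gate_vars_input[OF And.hyps(3)] by blast
  moreover have "gate_value C \<mu> h" if h: "h \<in> inputs C g" "h \<noteq> g'" for h
  proof -
    have "\<nu> x = \<mu> x" if "x \<in> gate_vars C h" for x
      using decomposable_disjoint[OF C dec And.hyps(2) h(1) And.hyps(3) h(2)] that And.prems by blast
    then have "gate_value C \<nu> h = gate_value C \<mu> h"
      by (rule gate_value_cong[OF C inputs_gates(1)[OF C h(1)]])
    then show ?thesis using And.hyps(4)[OF h] by simp
  qed
  ultimately show ?case
    using And.hyps(2,3) by (blast intro: path_context.And)
qed

section \<open>Mixing valuations, and balanced sets of variables\<close>

definition mix :: "'x set \<Rightarrow> ('x \<Rightarrow> bool) \<Rightarrow> ('x \<Rightarrow> bool) \<Rightarrow> 'x \<Rightarrow> bool" where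
  "mix A \<nu> \<mu> x = (if x \<in> A then \<nu> x else \<mu> x)"

text \<open>Both \<open>A\<close> and its complement then hold at least a third of \<open>W\<close>,
  which is what the isoperimetric bound consumes.\<close>

definition balanced :: "'x set \<Rightarrow> 'x set \<Rightarrow> bool" where
  "balanced W A \<longleftrightarrow> card W \<le> 3 * card (W \<inter> A) \<and> 3 * card (W \<inter> A) \<le> 2 * card W"

lemma balanced_between:
  assumes "finite W" "card W \<ge> 2" "P \<subseteq> Q"
    and P: "3 * card (W \<inter> P) \<le> 2 * card W" and Q: "2 * card W < 3 * card (W \<inter> Q)"
  obtains A where "P \<subseteq> A" "A \<subseteq> Q" "balanced W A"
proof (cases "card W \<le> 3 * card (W \<inter> P)")
  case True
  then show ?thesis using that[of P] assms by (auto simp: balanced_def)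
next
  case False
  \<comment> \<open>\<open>P\<close> is topped up from \<open>Q - P\<close> to the least integer not
    below a third of \<open>card W\<close>. As \<open>card W\<close> is at least 2, this rounding
    stays within two thirds.\<close>
  define k where "k = (card W + 2) div 3 - card (W \<inter> P)"
  have "card (W \<inter> Q) = card (W \<inter> P) + card (W \<inter> (Q - P))"
    using assms by (subst card_Un_disjoint[symmetric]) (auto intro: arg_cong[where f = card])
  then have "k \<le> card (W \<inter> (Q - P))"
    using Q False assms(2) unfolding k_def by linarith
  then obtain B where B: "B \<subseteq> W \<inter> (Q - P)" "card B = k"
    by (meson obtain_subset_with_card_n)
  have "W \<inter> (P \<union> B) = (W \<inter> P) \<union> B" using B by auto
  moreover have "finite B" "(W \<inter> P) \<inter> B = {}"
    using B assms(1) finite_subset[of B W] by auto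
  ultimately have "card (W \<inter> (P \<union> B)) = card (W \<inter> P) + k"
    using B(2) assms(1) by (simp add: card_Un_disjoint)
  also have "\<dots> = (card W + 2) div 3"
    using False unfolding k_def by linarith
  finally have "balanced W (P \<union> B)"
    using assms(2) unfolding balanced_def by linarith
  then show ?thesis using that[of "P \<union> B"] B assms(3) by blast
qed

text \<open>A part holding a third of \<open>W\<close> is balanced on its own. Otherwise an
  inclusion-minimal subfamily with share at least a third works: dropping one member leaves less
  than a third, and that member adds less than a third.\<close>

lemma balanced_Union:
  assumes "finite W" "finite I"
    and small: "\<And>i. i \<in> I \<Longrightarrow> 3 * card (W \<inter> P i) \<le> 2 * card W"
    and big: "card W \<le> 3 * card (W \<inter> \<Union> (P ` I))" and "W \<noteq> {}"
  obtains J where "J \<subseteq> I" "balanced W (\<Union> (P ` J))"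
proof (cases "\<exists>i \<in> I. card W \<le> 3 * card (W \<inter> P i)")
  case True
  then obtain i where "i \<in> I" "card W \<le> 3 * card (W \<inter> P i)" by blast
  then show ?thesis using that[of "{i}"] small[of i] by (auto simp: balanced_def)
next
  case False
  define \<J> where "\<J> = {J. J \<subseteq> I \<and> card W \<le> 3 * card (W \<inter> \<Union> (P ` J))}"
  have "finite \<J>" "\<J> \<noteq> {}"
    using big assms(2) unfolding \<J>_def by auto
  then obtain J where J: "J \<in> \<J>" and minimal: "\<And>K. K \<in> \<J> \<Longrightarrow> K \<subseteq> J \<Longrightarrow> K = J"
    using finite_has_minimal[of \<J>] by blast
  have "card W > 0" using assms by (simp add: card_gt_0_iff)
  with J obtain j where j: "j \<in> J"
    unfolding \<J>_def by fastforce
  have "J - {j} \<notin> \<J>"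
    using minimal[of "J - {j}"] j by blast
  then have "3 * card (W \<inter> \<Union> (P ` (J - {j}))) < card W"
    using J unfolding \<J>_def by auto
  moreover have "3 * card (W \<inter> P j) < card W"
    using False J j unfolding \<J>_def by force
  moreover have "card (W \<inter> \<Union> (P ` J)) \<le> card (W \<inter> \<Union> (P ` (J - {j}))) + card (W \<inter> P j)"
  proof -
    have "W \<inter> \<Union> (P ` J) \<subseteq> (W \<inter> \<Union> (P ` (J - {j}))) \<union> (W \<inter> P j)"
      by auto
    then have "card (W \<inter> \<Union> (P ` J)) \<le> card ((W \<inter> \<Union> (P ` (J - {j}))) \<union> (W \<inter> P j))"
      using assms(1) by (intro card_mono) auto
    then show ?thesis using card_Un_le order_trans by blast
  qed
  ultimately have "balanced W (\<Union> (P ` J))"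
    using J unfolding \<J>_def balanced_def by auto
  then show ?thesis using that[of J] J unfolding \<J>_def by auto
qed

text \<open>
  A satisfying assignment is assigned to the first wire, on a descent through true gates, at
  which the share of \<open>W\<close> below drops to at most two thirds. At a disjunction the balanced part may be
  any set between the variables of \<open>h\<close> and those of \<open>g\<close>, as the circuit need not be smooth; at a
  conjunction it collects the variables of some of the inputs.
\<close>

definition wire_rect :: "('g, 'x) circuit \<Rightarrow> 'x set \<Rightarrow> 'g \<times> 'g \<Rightarrow> ('x \<Rightarrow> bool) set" where
  "wire_rect C W w = (case w of (h, g) \<Rightarrow> {\<nu>. path_context C \<nu> g \<and> gate_value C \<nu> h \<and> gate_value C \<nu> g \<and>
     2 * card W < 3 * card (W \<inter> gate_vars C g) \<and>
     (glabel C g = Or \<and> 3 * card (W \<inter> gate_vars C h) \<le> 2 * card W \<or>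
      glabel C g = And \<and> (\<forall>k \<in> inputs C g. 3 * card (W \<inter> gate_vars C k) \<le> 2 * card W))})"

text \<open>Descend through true gates while the share of \<open>W\<close> stays above two thirds.
  Variable and negation gates see at most one variable, too few for that, so the descent stops at a
  disjunction or a conjunction.\<close>

lemma wire_rect_cover:
  assumes D: "DNNF X C" and W: "finite W" "card W \<ge> 2"
    and "path_context C \<nu> g" "gate_value C \<nu> g" "2 * card W < 3 * card (W \<inter> gate_vars C g)"
  shows "\<exists>w \<in> wires C. \<nu> \<in> wire_rect C W w"
proof -
  have C: "circuit_on X C" using D by (simp add: DNNF_def)
  from assms(4-6) show ?thesis
proof (induction g rule: wf_induct_rule[OF wf_wires[OF C]])
  case (1 g)
  note val = gate_value_rec[OF C, of \<nu> g]
  have g: "g \<in> gates C" using path_context_gates[OF C] 1 by blast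
  have few: "3 * card (W \<inter> S) \<le> 2 * card W" if "S \<subseteq> {x}" for S x
  proof -
    have "card (W \<inter> S) \<le> card {x}" using that by (intro card_mono) auto
    then show ?thesis using W by auto
  qed
  have leaf: "gate_vars C h \<subseteq> {x}" if "h \<in> gates C" "glabel C h = Var x" for h x
    using gate_vars_cases[of _ C h] C that unfolding circuit_on_def by fastforce
  show ?case
  proof (cases "glabel C g")
    case (Var x)
    then show ?thesis using few[OF leaf[OF g Var]] 1(4) by linarith
  next
    case Not
    then obtain h where h: "inputs C g = {h}"
      using C g unfolding circuit_on_def by (metis card_1_singletonE)
    obtain x where x: "glabel C h = Var x"
      using D g h Not unfolding DNNF_def negations_on_variables_def by blast
    have "gate_vars C g \<subseteq> gate_vars C h"
      using gate_vars_cases[of _ C g] h Not by auto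
    also have "\<dots> \<subseteq> {x}"
      using leaf[OF _ x] inputs_gates[OF C, of h g] h by auto
    finally have "3 * card (W \<inter> gate_vars C g) \<le> 2 * card W" by (rule few)
    then show ?thesis using 1(4) by linarith
  next
    case Or
    then obtain h where h: "h \<in> inputs C g" "gate_value C \<nu> h"
      using 1(3) val by auto
    then have w: "(h, g) \<in> wires C" by (simp add: inputs_def)
    show ?thesis
    proof (cases "3 * card (W \<inter> gate_vars C h) \<le> 2 * card W")
      case True
      then have "\<nu> \<in> wire_rect C W (h, g)"
        using 1(2-4) h Or by (auto simp: wire_rect_def)
      then show ?thesis using w by blast
    next
      case False
      then show ?thesis
        using 1(1)[OF w path_context.Or[OF 1(2) Or h(1)] h(2)] by linarith
    qed
  next
    case And
    then have tr: "gate_value C \<nu> h" if "h \<in> inputs C g" for h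
      using 1(3) val that by auto
    show ?thesis
    proof (cases "\<forall>k \<in> inputs C g. 3 * card (W \<inter> gate_vars C k) \<le> 2 * card W")
      case True
      \<comment> \<open>Any input can name the wire: at a true conjunction all inputs are true, so
        the condition is the same for each of them.\<close>
      have "inputs C g \<noteq> {}"
        using gate_vars_cases[of _ C g] And 1(4) by fastforce
      then obtain h where h: "h \<in> inputs C g" by blast
      then have "\<nu> \<in> wire_rect C W (h, g)"
        using 1(2-4) tr And True by (auto simp: wire_rect_def)
      then show ?thesis using h by (auto simp: inputs_def)
    next
      case False
      then obtain h where h: "h \<in> inputs C g" "2 * card W < 3 * card (W \<inter> gate_vars C h)"
        by force
      then have "(h, g) \<in> wires C" by (simp add: inputs_def)
      then show ?thesis
        using 1(1)[OF _ path_context.And[OF 1(2) And h(1) tr] tr[OF h(1)] h(2)] by blast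
    qed
  qed
qed
qed

text \<open>\<open>A\<close> lies below \<open>g\<close>, so the context of \<open>g\<close> is
  inherited from the second valuation. At a disjunction \<open>A\<close> contains all variables of
  \<open>h\<close>, which stays true as in the first valuation. At a conjunction each input has its
  variables entirely inside \<open>A\<close> or entirely outside, so it is true as in the first or
  in the second.\<close>

lemma wire_rect_mix:
  assumes D: "DNNF X C" and W: "finite W" "card W \<ge> 2"
    and w: "w \<in> wires C" and ne: "wire_rect C W w \<noteq> {}"
  obtains A where "balanced W A"
    "\<And>\<nu> \<mu>. \<nu> \<in> wire_rect C W w \<Longrightarrow> \<mu> \<in> wire_rect C W w \<Longrightarrow>
      gate_value C (mix A \<nu> \<mu>) (out_gate C)"
proof -
  have C: "circuit_on X C" and dec: "decomposable C" using D by (simp_all add: DNNF_def)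
  obtain h g where hg: "w = (h, g)" by force
  have h: "h \<in> inputs C g" using w hg by (simp add: inputs_def)
  have big: "2 * card W < 3 * card (W \<inter> gate_vars C g)"
    using ne by (auto simp: wire_rect_def hg)
  have context_mix: "path_context C (mix A \<nu> \<mu>) g"
    if "\<mu> \<in> wire_rect C W w" "A \<subseteq> gate_vars C g" for A \<nu> \<mu>
  proof (rule path_context_cong[OF C dec, of \<mu>])
    show "path_context C \<mu> g" using that(1) by (auto simp: wire_rect_def hg)
    show "\<mu> x = mix A \<nu> \<mu> x" if "x \<notin> gate_vars C g" for x
      using that \<open>A \<subseteq> gate_vars C g\<close> by (auto simp: mix_def)
  qed
  from ne consider (Or) "glabel C g = Or" "3 * card (W \<inter> gate_vars C h) \<le> 2 * card W"
    | (And) "glabel C g = And" "\<forall>k \<in> inputs C g. 3 * card (W \<inter> gate_vars C k) \<le> 2 * card W"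
    by (auto simp: wire_rect_def hg)
  then show ?thesis
  proof cases
    case Or
    obtain A where A: "gate_vars C h \<subseteq> A" "A \<subseteq> gate_vars C g" "balanced W A"
      using balanced_between[OF W gate_vars_input[OF h] Or(2) big] .
    show ?thesis
    proof (rule that[OF A(3)])
      fix \<nu> \<mu> assume R: "\<nu> \<in> wire_rect C W w" "\<mu> \<in> wire_rect C W w"
      have "gate_value C (mix A \<nu> \<mu>) h = gate_value C \<nu> h"
        using A(1) by (intro gate_value_cong[OF C inputs_gates(1)[OF C h]]) (auto simp: mix_def)
      then have "gate_value C (mix A \<nu> \<mu>) g"
        using R(1) h Or(1) by (auto simp: gate_value_rec[OF C, of _ g] wire_rect_def hg)
      then show "gate_value C (mix A \<nu> \<mu>) (out_gate C)"
        using path_context_sound[OF C context_mix[OF R(2) A(2)]] by blast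
    qed
  next
    case And
    have fin: "finite (inputs C g)"
      using C finite_subset[of "inputs C g" "gates C"] inputs_gates(1)[OF C]
      unfolding circuit_on_def by blast
    have "gate_vars C g = \<Union> (gate_vars C ` inputs C g)"
      using gate_vars_cases[of _ C g] gate_vars_input[of _ C g] And(1) by fastforce
    then have "card W \<le> 3 * card (W \<inter> \<Union> (gate_vars C ` inputs C g))"
      using big by simp
    moreover have "W \<noteq> {}" using W by auto
    moreover have "3 * card (W \<inter> gate_vars C k) \<le> 2 * card W" if "k \<in> inputs C g" for k
      using And(2) that by blast
    ultimately obtain J where J: "J \<subseteq> inputs C g" "balanced W (\<Union> (gate_vars C ` J))"
      using balanced_Union[of W "inputs C g" "gate_vars C", OF W(1) fin] by metis
    define A where "A = \<Union> (gate_vars C ` J)"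
    have A: "A \<subseteq> gate_vars C g"
      unfolding A_def by (intro UN_least gate_vars_input subsetD[OF J(1)])
    show ?thesis
    proof (rule that[OF J(2)], fold A_def)
      fix \<nu> \<mu> assume R: "\<nu> \<in> wire_rect C W w" "\<mu> \<in> wire_rect C W w"
      have "gate_value C (mix A \<nu> \<mu>) k" if k: "k \<in> inputs C g" for k
      proof -
        have tr: "gate_value C \<nu> k" "gate_value C \<mu> k"
          using R k And(1) by (auto simp: gate_value_rec[OF C, of _ g] wire_rect_def hg)
        show ?thesis
        proof (cases "k \<in> J")
          case True
          have "gate_value C (mix A \<nu> \<mu>) k = gate_value C \<nu> k"
            using True by (intro gate_value_cong[OF C inputs_gates(1)[OF C k]]) (auto simp: mix_def A_def)
          then show ?thesis using tr by simp
        next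
          case False
          have "x \<notin> A" if "x \<in> gate_vars C k" for x
            using decomposable_disjoint[OF C dec And(1) k] J(1) False that unfolding A_def by blast
          then have "gate_value C (mix A \<nu> \<mu>) k = gate_value C \<mu> k"
            by (intro gate_value_cong[OF C inputs_gates(1)[OF C k]]) (auto simp: mix_def)
          then show ?thesis using tr by simp
        qed
      qed
      then have "gate_value C (mix A \<nu> \<mu>) g"
        using And(1) by (auto simp: gate_value_rec[OF C, of _ g])
      then show "gate_value C (mix A \<nu> \<mu>) (out_gate C)"
        using path_context_sound[OF C context_mix[OF R(2) A]] by blast
    qed
  qed
qed

text \<open>The variables of \<open>W\<close> are essential, hence all occur below the output, where
  the descent can start. The mixtures of members of \<open>R w\<close> form a combinatorial
  rectangle that contains \<open>R w\<close> and lies inside \<open>f\<close>.\<close>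

theorem DNNF_rectangle_cover:
  assumes D: "DNNF X C" and f: "circuit_computes C f" and W: "finite W" "card W \<ge> 2"
    and dep: "\<And>x. x \<in> W \<Longrightarrow> \<exists>\<nu>. f (\<nu>(x := True)) \<noteq> f (\<nu>(x := False))"
  obtains R where "\<And>\<nu>. f \<nu> \<Longrightarrow> \<exists>w \<in> wires C. \<nu> \<in> R w"
    and "\<And>w. w \<in> wires C \<Longrightarrow> R w \<noteq> {} \<Longrightarrow>
      \<exists>A. balanced W A \<and> (\<forall>\<nu> \<in> R w. \<forall>\<mu> \<in> R w. f (mix A \<nu> \<mu>))"
proof
  have C: "circuit_on X C" using D by (simp add: DNNF_def)
  have "W \<subseteq> gate_vars C (out_gate C)"
  proof
    fix x assume "x \<in> W"
    then obtain \<nu> where \<nu>: "f (\<nu>(x := True)) \<noteq> f (\<nu>(x := False))" using dep by blast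
    show "x \<in> gate_vars C (out_gate C)"
    proof (rule ccontr)
      assume "x \<notin> gate_vars C (out_gate C)"
      then have "gate_value C (\<nu>(x := True)) (out_gate C) = gate_value C (\<nu>(x := False)) (out_gate C)"
        using C by (intro gate_value_cong[OF C]) (auto simp: circuit_on_def)
      then show False using \<nu> f by (simp add: circuit_computes_def)
    qed
  qed
  then have "W \<inter> gate_vars C (out_gate C) = W" by blast
  then show "\<exists>w \<in> wires C. \<nu> \<in> wire_rect C W w" if "f \<nu>" for \<nu>
    using that f W wire_rect_cover[OF D W path_context.out, of \<nu>]
    by (auto simp: circuit_computes_def)
  show "\<exists>A. balanced W A \<and> (\<forall>\<nu> \<in> wire_rect C W w. \<forall>\<mu> \<in> wire_rect C W w. f (mix A \<nu> \<mu>))"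
    if "w \<in> wires C" "wire_rect C W w \<noteq> {}" for w
    using wire_rect_mix[OF D W that] f unfolding circuit_computes_def by metis
qed

subsection \<open>Sparse random independent sets\<close>

text \<open>
  For \<open>g\<close> drawn uniformly from the functions into \<open>{..d}\<close>, the vertices satisfying this form a random
  independent set with density of order \<open>1 / d\<close> when degrees are at most \<open>d\<close>.
\<close>

definition selected :: "('a \<times> 'a) set \<Rightarrow> ('a \<Rightarrow> nat) \<Rightarrow> 'a \<Rightarrow> bool" where
  "selected E g v \<longleftrightarrow> g v = 0 \<and> (\<forall>u \<in> closed_nbhd E v - {v}. g u \<noteq> 0)"

lemma selected_cong:
  assumes "\<And>u. u \<in> closed_nbhd E v \<Longrightarrow> g u = g' u"
  shows "selected E g v = selected E g' v"
proof -
  have "v \<in> closed_nbhd E v" by (simp add: closed_nbhd_def)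
  then show ?thesis using assms by (simp add: selected_def)
qed

lemma selected_independent:
  "(u, v) \<in> E \<Longrightarrow> u \<noteq> v \<Longrightarrow> \<not> (selected E g u \<and> selected E g v)"
  unfolding selected_def closed_nbhd_def by auto

text \<open>The chance that \<open>j\<close> independent uniform draws from \<open>{..d}\<close> all
  avoid 0; it is bounded below because \<open>(1 + 1 / d) ^ d\<close> is at most
  \<open>exp 1\<close>.\<close>

lemma one_minus_inverse_Suc_power_ge:
  assumes "j \<le> d"
  shows "1 / 4 \<le> (real d / (real d + 1)) ^ j"
proof (cases "d = 0")
  case False
  have "(1 + 1 / real d) ^ d \<le> exp (1 / real d) ^ d"
    by (intro power_mono exp_ge_add_one_self) auto
  also have "\<dots> = exp 1"
    using False by (simp flip: exp_of_nat_mult)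
  also have "\<dots> \<le> 4"
    using exp_le by simp
  finally have "1 / 4 \<le> 1 / (1 + 1 / real d) ^ d"
    using False by (simp add: field_simps)
  also have "\<dots> = (real d / (real d + 1)) ^ d"
    using False by (simp add: field_simps flip: power_one_over power_divide)
  also have "\<dots> \<le> (real d / (real d + 1)) ^ j"
    using assms by (intro power_decreasing) auto
  finally show ?thesis .
qed (use assms in simp)

text \<open>Selection of \<open>t\<close> asks for 0 at \<open>t\<close>, of probability
  \<open>1 / (d + 1)\<close>, and for nonzero values at its at most \<open>d\<close> neighbours, of
  probability at least 1/4.\<close>

lemma card_not_selected:
  assumes fin: "finite (closed_nbhd E t)" and k: "card (closed_nbhd E t) \<le> Suc d"
  shows "real (card {g \<in> closed_nbhd E t \<rightarrow>\<^sub>E {..d}. \<not> selected E g t})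
    \<le> (1 - 1 / (4 * (real d + 1))) * (real d + 1) ^ card (closed_nbhd E t)"
proof -
  let ?K = "closed_nbhd E t"
  let ?F = "?K \<rightarrow>\<^sub>E {..d}"
  let ?S = "PiE ?K (\<lambda>u. if u = t then {0} else {1..d})"
  have t: "t \<in> ?K" by (simp add: closed_nbhd_def)
  define j where "j = card (?K - {t})"
  have K: "card ?K = Suc j"
    unfolding j_def using card_Suc_Diff1[OF fin t] by simp
  have "?S \<subseteq> ?F" "{g \<in> ?F. \<not> selected E g t} \<subseteq> ?F - ?S"
    using t by (fastforce simp: selected_def PiE_iff split: if_splits)+
  moreover have "finite ?F" "finite ?S" using fin by (auto intro!: finite_PiE)
  ultimately have "card {g \<in> ?F. \<not> selected E g t} \<le> card ?F - card ?S"
    using card_mono[of "?F - ?S" "{g \<in> ?F. \<not> selected E g t}"] card_Diff_subset[of ?S ?F] by simp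
  moreover have "card ?S \<le> card ?F"
    using \<open>?S \<subseteq> ?F\<close> fin by (intro card_mono finite_PiE) auto
  ultimately have "real (card {g \<in> ?F. \<not> selected E g t}) \<le> real (card ?F) - real (card ?S)"
    by linarith
  also have "real (card ?F) = (real d + 1) ^ Suc j"
    using fin by (simp add: card_PiE K algebra_simps)
  also have "real (card ?S) = real d ^ j"
  proof -
    have "card ?S = (\<Prod>u \<in> insert t (?K - {t}). card (if u = t then {0} else {1..d}))"
      using fin t by (simp add: card_PiE insert_absorb)
    also have "\<dots> = (\<Prod>u \<in> ?K - {t}. d)"
      using fin by (subst prod.insert) (auto intro: prod.cong)
    finally show ?thesis by (simp add: j_def)
  qed
  also have "(real d + 1) ^ Suc j - real d ^ j \<le> (1 - 1 / (4 * (real d + 1))) * (real d + 1) ^ Suc j"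
  proof -
    have "1 / 4 * (real d + 1) ^ j \<le> (real d / (real d + 1)) ^ j * (real d + 1) ^ j"
      using one_minus_inverse_Suc_power_ge[of j d] k K by (intro mult_right_mono) auto
    also have "\<dots> = real d ^ j"
      by (simp flip: power_mult_distrib)
    finally have "1 / 4 * (real d + 1) ^ j \<le> real d ^ j" .
    moreover have "(1 - 1 / (4 * (real d + 1))) * (real d + 1) ^ Suc j
      = (real d + 1) ^ Suc j - 1 / 4 * (real d + 1) ^ j"
      by (simp add: field_simps)
    ultimately show ?thesis
      by linarith
  qed
  finally show ?thesis by (simp only: K)
qed

text \<open>Selection depends only on the closed neighbourhood, so disjoint neighbourhoods give
  independent events. In counting form, a function is determined by its restrictions to one
  neighbourhood and to the rest of \<open>V\<close>, and the induction handles the rest.\<close>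

lemma card_none_selected:
  assumes "finite T" "finite V" "\<And>t. t \<in> T \<Longrightarrow> closed_nbhd E t \<subseteq> V"
    and "\<And>t. t \<in> T \<Longrightarrow> card (closed_nbhd E t) \<le> Suc d"
    and "\<And>t t'. t \<in> T \<Longrightarrow> t' \<in> T \<Longrightarrow> t \<noteq> t' \<Longrightarrow> closed_nbhd E t \<inter> closed_nbhd E t' = {}"
  shows "real (card {g \<in> V \<rightarrow>\<^sub>E {..d}. \<forall>t \<in> T. \<not> selected E g t})
    \<le> (1 - 1 / (4 * (real d + 1))) ^ card T * (real d + 1) ^ card V"
  using assms
proof (induction T arbitrary: V rule: finite_induct)
  case empty
  then show ?case by (simp add: card_PiE add.commute)
next
  case (insert t T)
  let ?K = "closed_nbhd E t"
  have K: "?K \<subseteq> V" "finite ?K"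
    using insert.prems by (auto intro: finite_subset)
  define L where "L = {g \<in> V \<rightarrow>\<^sub>E {..d}. \<forall>t \<in> insert t T. \<not> selected E g t}"
  define L1 where "L1 = {g \<in> ?K \<rightarrow>\<^sub>E {..d}. \<not> selected E g t}"
  define L2 where "L2 = {g \<in> V - ?K \<rightarrow>\<^sub>E {..d}. \<forall>t \<in> T. \<not> selected E g t}"
  let ?\<phi> = "\<lambda>g. (restrict g ?K, restrict g (V - ?K))"
  have nb: "closed_nbhd E s \<subseteq> V - ?K" if "s \<in> T" for s
    using insert.prems(2)[of s] insert.prems(4)[of s t] insert.hyps(2) that by blast
  have fin: "finite L1" "finite L2"
    unfolding L1_def L2_def using K insert.prems(1)
    by (simp_all add: finite_PiE)
  have "inj_on ?\<phi> L"
  proof (rule inj_onI)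
    fix g g' assume g: "g \<in> L" "g' \<in> L" "?\<phi> g = ?\<phi> g'"
    show "g = g'"
    proof (rule PiE_ext)
      show "g \<in> V \<rightarrow>\<^sub>E {..d}" "g' \<in> V \<rightarrow>\<^sub>E {..d}" using g by (auto simp: L_def)
      fix x assume "x \<in> V"
      moreover have "restrict g ?K x = restrict g' ?K x"
        "restrict g (V - ?K) x = restrict g' (V - ?K) x"
        using g(3) by simp_all
      ultimately show "g x = g' x"
        by (cases "x \<in> ?K") auto
    qed
  qed
  moreover have "?\<phi> ` L \<subseteq> L1 \<times> L2"
  proof (rule image_subsetI)
    fix g assume g: "g \<in> L"
    have "selected E (restrict g ?K) t = selected E g t"
      by (rule selected_cong) simp
    moreover have "selected E (restrict g (V - ?K)) s = selected E g s" if "s \<in> T" for s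
      using nb[OF that] by (intro selected_cong) auto
    ultimately show "?\<phi> g \<in> L1 \<times> L2"
      using g K unfolding L_def L1_def L2_def by (auto simp: PiE_iff)
  qed
  ultimately have "card L \<le> card (L1 \<times> L2)"
    using fin by (intro card_inj_on_le) simp_all
  then have "card L \<le> card L1 * card L2"
    by (simp only: card_cartesian_product)
  then have "real (card L) \<le> real (card L1) * real (card L2)"
    by (simp flip: of_nat_mult)
  also have "\<dots> \<le> ((1 - 1 / (4 * (real d + 1))) * (real d + 1) ^ card ?K)
    * ((1 - 1 / (4 * (real d + 1))) ^ card T * (real d + 1) ^ card (V - ?K))"
  proof (rule mult_mono)
    show "real (card L1) \<le> (1 - 1 / (4 * (real d + 1))) * (real d + 1) ^ card ?K"
      unfolding L1_def using card_not_selected[OF K(2)] insert.prems(3) by blast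
    show "real (card L2) \<le> (1 - 1 / (4 * (real d + 1))) ^ card T * (real d + 1) ^ card (V - ?K)"
      unfolding L2_def
    proof (rule insert.IH)
      show "finite (V - ?K)" using insert.prems(1) by blast
      show "closed_nbhd E s \<subseteq> V - ?K" if "s \<in> T" for s using nb[OF that] .
    qed (use insert.prems in auto)
  qed auto
  also have "\<dots> = (1 - 1 / (4 * (real d + 1))) ^ card (insert t T)
    * (real d + 1) ^ (card ?K + card (V - ?K))"
    using insert.hyps by (simp add: power_add)
  also have "card ?K + card (V - ?K) = card V"
    using K insert.prems(1) by (simp add: card_Diff_subset card_mono)
  finally show ?case unfolding L_def .
qed

text \<open>Take a maximal subset of \<open>Z\<close> with disjoint neighbourhoods. By maximality
  every vertex of \<open>Z\<close> is within distance two of it, and such a ball has at most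
  \<open>D * D\<close> vertices.\<close>

lemma disjoint_nbhds_exist:
  assumes "finite V" "Z \<subseteq> V" "\<And>v. v \<in> V \<Longrightarrow> closed_nbhd E v \<subseteq> V"
    and D: "\<And>v. v \<in> V \<Longrightarrow> card (closed_nbhd E v) \<le> D"
  obtains T where "T \<subseteq> Z" "card Z \<le> D\<^sup>2 * card T"
    "\<And>t t'. t \<in> T \<Longrightarrow> t' \<in> T \<Longrightarrow> t \<noteq> t' \<Longrightarrow> closed_nbhd E t \<inter> closed_nbhd E t' = {}"
proof -
  let ?ok = "\<lambda>T. \<forall>t \<in> T. \<forall>t' \<in> T. t \<noteq> t' \<longrightarrow> closed_nbhd E t \<inter> closed_nbhd E t' = {}"
  define \<T> where "\<T> = {T. T \<subseteq> Z \<and> ?ok T}"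
  have finZ: "finite Z" using assms finite_subset by blast
  then have "finite \<T>" unfolding \<T>_def by auto
  moreover have "{} \<in> \<T>" unfolding \<T>_def by auto
  ultimately obtain T where T: "T \<in> \<T>" and maximal: "\<And>S. S \<in> \<T> \<Longrightarrow> T \<subseteq> S \<Longrightarrow> S = T"
    using finite_has_maximal[of \<T>] by blast
  have "T \<subseteq> V" "finite T" using T finZ assms(2) finite_subset unfolding \<T>_def by auto
  have fin: "finite (closed_nbhd E v)" if "v \<in> V" for v
    using that assms(1,3) finite_subset by blast
  have sym: "z \<in> closed_nbhd E u \<longleftrightarrow> u \<in> closed_nbhd E z" for z u
    by (auto simp: closed_nbhd_def)
  have "Z \<subseteq> (\<Union>t \<in> T. \<Union>u \<in> closed_nbhd E t. closed_nbhd E u)"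
  proof
    fix z assume z: "z \<in> Z"
    have "\<exists>t \<in> T. closed_nbhd E t \<inter> closed_nbhd E z \<noteq> {}"
    proof (rule ccontr)
      assume *: "\<not> ?thesis"
      have "insert z T \<in> \<T>"
        using T z * unfolding \<T>_def by (auto simp: Int_commute)
      then have "z \<in> T" using maximal by blast
      then show False using * by (auto simp: closed_nbhd_def)
    qed
    then show "z \<in> (\<Union>t \<in> T. \<Union>u \<in> closed_nbhd E t. closed_nbhd E u)"
      using sym by blast
  qed
  then have "card Z \<le> card (\<Union>t \<in> T. \<Union>u \<in> closed_nbhd E t. closed_nbhd E u)"
    using \<open>T \<subseteq> V\<close> \<open>finite T\<close> fin assms(3) by (intro card_mono finite_UN_I) blast+
  also have "\<dots> \<le> (\<Sum>t \<in> T. card (\<Union>u \<in> closed_nbhd E t. closed_nbhd E u))"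
    by (rule card_UN_le[OF \<open>finite T\<close>])
  also have "\<dots> \<le> (\<Sum>t \<in> T. D * D)"
  proof (rule sum_mono)
    fix t assume "t \<in> T"
    then have t: "t \<in> V" using \<open>T \<subseteq> V\<close> by blast
    have "card (\<Union>u \<in> closed_nbhd E t. closed_nbhd E u) \<le> (\<Sum>u \<in> closed_nbhd E t. card (closed_nbhd E u))"
      by (rule card_UN_le[OF fin[OF t]])
    also have "\<dots> \<le> (\<Sum>u \<in> closed_nbhd E t. D)"
      using assms(3)[OF t] D by (intro sum_mono) blast
    also have "\<dots> \<le> D * D"
      using D[OF t] by simp
    finally show "card (\<Union>u \<in> closed_nbhd E t. closed_nbhd E u) \<le> D * D" .
  qed
  also have "\<dots> = D\<^sup>2 * card T" by (simp add: power2_eq_square)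
  finally show ?thesis
    using that[of T] T unfolding \<T>_def by blast
qed

lemma closed_nbhd_cube_subset: "v < 2 ^ d \<Longrightarrow> closed_nbhd (cube d) v \<subseteq> {..<2 ^ d}"
  using cube_subset[of d] by (auto simp: closed_nbhd_def)

text \<open>\<open>spec\<close> describes \<open>f\<close> only where every variable outside the
  image of \<open>enc\<close> is true; this is the slice in which all edges below the first level of
  the tree are present.\<close>

theorem DNNF_cube_vertex_cover:
  fixes enc :: "nat \<Rightarrow> 'x"
  assumes d: "d > 0" and D: "DNNF X C" and f: "circuit_computes C f"
    and inj: "inj_on enc {..<2 ^ d}"
    and spec: "\<And>\<nu>. (\<And>x. x \<notin> enc ` {..<2 ^ d} \<Longrightarrow> \<nu> x) \<Longrightarrow>
      f \<nu> \<longleftrightarrow> (\<forall>(u, v) \<in> cube d. \<nu> (enc u) \<or> \<nu> (enc v))"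
  shows "2 powr (2 ^ d / (12 * (real d + 1) ^ 4)) \<le> real (circuit_size C)"
proof -
  let ?V = "{..<(2::nat) ^ d}"
  let ?E = "cube d"
  let ?N = "closed_nbhd ?E"
  define W where "W = enc ` ?V"
  have encI: "enc u = enc v \<longleftrightarrow> u = v" if "u < 2 ^ d" "v < 2 ^ d" for u v
    using that inj by (auto simp: inj_on_def)
  have W: "finite W" "card W = 2 ^ d"
    using inj by (auto simp: W_def card_image)
  have "card W \<ge> 2"
    using W(2) self_le_power[of 2 d] d by simp
  have dep: "\<exists>\<nu>. f (\<nu>(x := True)) \<noteq> f (\<nu>(x := False))" if "x \<in> W" for x
  proof -
    obtain v where v: "v < 2 ^ d" "x = enc v" using \<open>x \<in> W\<close> by (auto simp: W_def)
    obtain u where u: "(u, v) \<in> ?E \<or> (v, u) \<in> ?E"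
      using cube_neighbour_exists[OF v(1) d] .
    then have uv: "u < 2 ^ d" "u \<noteq> v"
      using cube_bounds[of u v d] cube_bounds[of v u d] by auto
    \<comment> \<open>With every vertex but the neighbour \<open>u\<close> in the cover, the edge
      between \<open>u\<close> and \<open>v\<close> makes \<open>v\<close> decisive.\<close>
    let ?\<nu> = "\<lambda>y. y \<noteq> enc u"
    have "f (?\<nu>(x := True))"
    proof (subst spec)
      show "\<forall>(a, b) \<in> ?E. (?\<nu>(x := True)) (enc a) \<or> (?\<nu>(x := True)) (enc b)"
      proof clarify
        fix a b assume "(a, b) \<in> ?E" "\<not> (?\<nu>(x := True)) (enc b)"
        then show "(?\<nu>(x := True)) (enc a)"
          using cube_bounds[of a b d] uv by (auto split: if_splits simp: encI)
      qed
    qed (use uv in \<open>auto\<close>)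
    moreover have "\<not> f (?\<nu>(x := False))"
    proof (subst spec)
      show "\<not> (\<forall>(a, b) \<in> ?E. (?\<nu>(x := False)) (enc a) \<or> (?\<nu>(x := False)) (enc b))"
      proof
        assume "\<forall>(a, b) \<in> ?E. (?\<nu>(x := False)) (enc a) \<or> (?\<nu>(x := False)) (enc b)"
        with u have "(?\<nu>(x := False)) (enc u) \<or> (?\<nu>(x := False)) (enc v)" by blast
        then show False by (simp add: v(2) split: if_splits)
      qed
    qed (use v uv in auto)
    ultimately show ?thesis by blast
  qed
  obtain R where cover: "\<And>\<nu>. f \<nu> \<Longrightarrow> \<exists>w \<in> wires C. \<nu> \<in> R w"
    and rect: "\<And>w. w \<in> wires C \<Longrightarrow> R w \<noteq> {} \<Longrightarrow>
      \<exists>A. balanced W A \<and> (\<forall>\<nu> \<in> R w. \<forall>\<mu> \<in> R w. f (mix A \<nu> \<mu>))"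
    using DNNF_rectangle_cover[OF D f W(1) \<open>card W \<ge> 2\<close> dep] by metis
  define F where "F = ?V \<rightarrow>\<^sub>E {..d}"
  \<comment> \<open>The complement of the random independent set, hence always a vertex
    cover.\<close>
  define val where "val g = (\<lambda>x. \<not> (\<exists>v < 2 ^ d. x = enc v \<and> selected ?E g v))" for g
  have val: "val g (enc v) \<longleftrightarrow> \<not> selected ?E g v" if "v < 2 ^ d" for g v
    using that encI by (auto simp: val_def)
  have val_out: "val g x" if "x \<notin> enc ` ?V" for g x
    using that by (auto simp: val_def)
  have bounds: "u < 2 ^ d" "v < 2 ^ d" "u < v" if "(u, v) \<in> ?E" for u v
    using cube_bounds[OF that] by auto
  have f_val: "f (val g)" for g
    using selected_independent[of _ _ ?E g] bounds val
    by (subst spec[OF val_out]) fastforce+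
  \<comment> \<open>\<open>q\<close> bounds the selection probability from below, and
    \<open>t\<close> the number of vertices with disjoint neighbourhoods that a rectangle fixes: a
    third for balance, a factor \<open>d + 1\<close> from cut edges to vertices, and its square for
    the packing.\<close>
  define q where "q = 1 / (4 * (real d + 1))"
  define t where "t = 2 ^ d / (3 * (real d + 1) ^ 3)"
  have q: "0 \<le> q" "q \<le> 1" by (auto simp: q_def field_simps)
  have wire: "real (card {g \<in> F. val g \<in> R w}) \<le> exp (- q * t) * (real d + 1) ^ 2 ^ d"
    if w: "w \<in> wires C" for w
  proof (cases "R w = {}")
    case False
    then obtain A where A: "balanced W A" "\<And>\<nu> \<mu>. \<nu> \<in> R w \<Longrightarrow> \<mu> \<in> R w \<Longrightarrow> f (mix A \<nu> \<mu>)"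
      using rect[OF w] by blast
    define B where "B = enc -` A"
    \<comment> \<open>The vertices that belong to every sampled cover in this rectangle.\<close>
    define Z where "Z = {v \<in> ?V. \<forall>g. val g \<in> R w \<longrightarrow> \<not> selected ?E g v}"
    have "W \<inter> A = enc ` (?V \<inter> B)" by (auto simp: W_def B_def)
    then have "card (W \<inter> A) = card (?V \<inter> B)"
      using inj by (simp add: card_image inj_on_subset)
    moreover have "card (?V \<inter> B) + card (?V \<inter> - B) = 2 ^ d"
    proof -
      have "card (?V \<inter> B) + card (?V \<inter> - B) = card ((?V \<inter> B) \<union> (?V \<inter> - B))"
        by (subst card_Un_disjoint) auto
      also have "(?V \<inter> B) \<union> (?V \<inter> - B) = ?V" by auto
      finally show ?thesis by simp
    qed
    ultimately have cut: "2 ^ d \<le> 3 * card (cut_edges ?E B)"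
      using A(1) cube_edge_isoperimetry[of d B] unfolding balanced_def W(2) by linarith
    \<comment> \<open>Otherwise one sampled cover omits \<open>u\<close> and another omits
      \<open>v\<close>; mixing along \<open>A\<close> omits both and leaves the edge
      uncovered.\<close>
    have *: "u \<in> Z \<or> v \<in> Z" if e: "(u, v) \<in> ?E \<or> (v, u) \<in> ?E" and "u \<in> B" "v \<notin> B" for u v
    proof (rule ccontr)
      assume "\<not> ?thesis"
      moreover have uv: "u < 2 ^ d" "v < 2 ^ d" using e bounds by blast+
      ultimately obtain g g' where g: "val g \<in> R w" "selected ?E g u"
        and g': "val g' \<in> R w" "selected ?E g' v"
        unfolding Z_def by auto
      have "f (mix A (val g) (val g'))" using A(2) g g' by blast
      moreover have "mix A (val g) (val g') x" if "x \<notin> enc ` ?V" for x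
        using val_out that by (simp add: mix_def)
      ultimately have "\<forall>(u, v) \<in> ?E. mix A (val g) (val g') (enc u) \<or> mix A (val g) (val g') (enc v)"
        using spec by blast
      then have "mix A (val g) (val g') (enc u) \<or> mix A (val g) (val g') (enc v)"
        using e by auto
      then show False
        using \<open>u \<in> B\<close> \<open>v \<notin> B\<close> g g' val uv by (auto simp: mix_def B_def)
    qed
    \<comment> \<open>Edges are listed smaller end first, so \<open>min\<close> and
      \<open>max\<close> recover an edge from its end in \<open>Z\<close> and the other end. Each
      vertex of \<open>Z\<close> thus accounts for at most \<open>d + 1\<close> cut edges.\<close>
    have "cut_edges ?E B \<subseteq> (\<Union>z \<in> Z. (\<lambda>u. (min u z, max u z)) ` ?N z)"
    proof clarify
      fix u v assume uv: "(u, v) \<in> cut_edges ?E B"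
      then have e: "(u, v) \<in> ?E" by (simp add: cut_edges_def)
      then have "(u, v) = (min u v, max u v)" "(u, v) = (min v u, max v u)"
        using bounds(3) by auto
      moreover have "u \<in> ?N v" "v \<in> ?N u" using e by (auto simp: closed_nbhd_def)
      moreover have "u \<in> Z \<or> v \<in> Z"
        using *[of u v] *[of v u] uv e by (auto simp: cut_edges_def)
      ultimately show "(u, v) \<in> (\<Union>z \<in> Z. (\<lambda>u. (min u z, max u z)) ` ?N z)"
        by blast
    qed
    moreover have "finite Z" "Z \<subseteq> ?V" by (auto simp: Z_def)
    moreover have finN: "finite (?N z)" for z by (rule finite_closed_nbhd[OF finite_cube])
    ultimately have "card (cut_edges ?E B) \<le> card (\<Union>z \<in> Z. (\<lambda>u. (min u z, max u z)) ` ?N z)"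
      by (intro card_mono finite_UN_I finite_imageI)
    also have "\<dots> \<le> (\<Sum>z \<in> Z. card ((\<lambda>u. (min u z, max u z)) ` ?N z))"
      by (rule card_UN_le[OF \<open>finite Z\<close>])
    also have "\<dots> \<le> (\<Sum>z \<in> Z. Suc d)"
    proof (rule sum_mono)
      fix z assume "z \<in> Z"
      then have "card (?N z) \<le> Suc d"
        using \<open>Z \<subseteq> ?V\<close> by (intro card_closed_nbhd_cube) auto
      then show "card ((\<lambda>u. (min u z, max u z)) ` ?N z) \<le> Suc d"
        using card_image_le[OF finN] order_trans by blast
    qed
    finally have cutZ: "card (cut_edges ?E B) \<le> Suc d * card Z" by (simp add: mult.commute)
    obtain T where T: "T \<subseteq> Z" "card Z \<le> (Suc d)\<^sup>2 * card T"
      "\<And>t t'. t \<in> T \<Longrightarrow> t' \<in> T \<Longrightarrow> t \<noteq> t' \<Longrightarrow> ?N t \<inter> ?N t' = {}"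
      using disjoint_nbhds_exist[of ?V Z ?E "Suc d"] \<open>Z \<subseteq> ?V\<close>
        closed_nbhd_cube_subset[of _ d] card_closed_nbhd_cube[of _ d] by auto
    have "2 ^ d \<le> 3 * (Suc d * ((Suc d)\<^sup>2 * card T))"
      using cut cutZ T(2) by (meson le_trans mult_le_mono2)
    then have "real (2 ^ d) \<le> real (3 * (Suc d * ((Suc d)\<^sup>2 * card T)))"
      by (rule of_nat_mono)
    also have "\<dots> = real (card T) * (3 * (real d + 1) ^ 3)"
      by (simp add: power3_eq_cube power2_eq_square algebra_simps)
    finally have tT: "t \<le> real (card T)"
      unfolding t_def by (subst pos_divide_le_eq) simp_all
    have TV: "T \<subseteq> ?V" using T(1) \<open>Z \<subseteq> ?V\<close> by blast
    have "card {g \<in> F. val g \<in> R w} \<le> card {g \<in> F. \<forall>t \<in> T. \<not> selected ?E g t}"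
      using T(1) by (intro card_mono) (auto simp: F_def Z_def intro!: finite_PiE)
    also have "real \<dots> \<le> (1 - q) ^ card T * (real d + 1) ^ card ?V"
      unfolding F_def q_def
    proof (rule card_none_selected)
      show "?N t \<subseteq> ?V" "card (?N t) \<le> Suc d" if "t \<in> T" for t
        using closed_nbhd_cube_subset[of t d] card_closed_nbhd_cube[of t d] that TV by auto
    qed (use T(3) finite_subset[OF TV] in auto)
    also have "\<dots> \<le> exp (- q * t) * (real d + 1) ^ card ?V"
    proof (rule mult_right_mono)
      have "(1 - q) ^ card T \<le> exp (- q) ^ card T"
        using q exp_ge_add_one_self[of "- q"] by (intro power_mono) auto
      also have "\<dots> = exp (- q * real (card T))"
        by (simp add: mult.commute flip: exp_of_nat_mult)
      also have "\<dots> \<le> exp (- q * t)"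
        using tT q by (simp add: mult_left_mono)
      finally show "(1 - q) ^ card T \<le> exp (- q * t)" .
    qed auto
    finally show ?thesis by simp
  qed auto
  have finC: "finite (wires C)"
    using D finite_subset unfolding DNNF_def circuit_on_def by blast
  \<comment> \<open>Union bound: every sample lies in the rectangle of some wire, and each rectangle
    catches an exponentially small fraction.\<close>
  have "(real d + 1) ^ 2 ^ d = real (card F)"
    by (simp add: F_def card_PiE add.commute)
  also have "F = (\<Union>w \<in> wires C. {g \<in> F. val g \<in> R w})"
    using cover[OF f_val] by blast
  also have "real (card \<dots>) \<le> real (\<Sum>w \<in> wires C. card {g \<in> F. val g \<in> R w})"
    using card_UN_le[OF finC] by (intro of_nat_mono)
  also have "\<dots> \<le> (\<Sum>w \<in> wires C. exp (- q * t) * (real d + 1) ^ 2 ^ d)"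
    unfolding of_nat_sum by (intro sum_mono wire)
  also have "\<dots> = real (circuit_size C) * exp (- q * t) * (real d + 1) ^ 2 ^ d"
    by (simp add: circuit_size_def)
  finally have "1 \<le> real (circuit_size C) * exp (- q * t)"
    by simp
  then have "exp (q * t) \<le> real (circuit_size C)"
    by (simp add: exp_minus field_simps)
  moreover have "q * t = 2 ^ d / (12 * (real d + 1) ^ 4)"
    by (simp add: q_def t_def power4_eq_xxxx power3_eq_cube algebra_simps)
  moreover have "2 powr (q * t) \<le> exp (q * t)"
  proof -
    have "q * t * ln 2 \<le> q * t * 1"
      using q(1) ln_2_less_1 by (intro mult_left_mono) (auto simp: t_def)
    then show ?thesis by (simp add: powr_def mult.commute)
  qed
  ultimately show ?thesis by simp
qed

subsection \<open>Encoding vertex covers in a path query and a tree\<close>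

definition clause_code :: "nat \<Rightarrow> nat \<times> nat \<Rightarrow> nat" where
  "clause_code d e = fst e + 2 ^ d * snd e"

text \<open>Level 0 is the edge leaving the root. It carries no code bit, so its label does not
  reveal which vertex is chosen; level \<open>k > 0\<close> carries bit \<open>k - 1\<close> of the
  code.\<close>

definition level_label :: "'s \<Rightarrow> 's \<Rightarrow> nat \<Rightarrow> nat \<Rightarrow> 's" where
  "level_label p q c k = (if k \<noteq> 0 \<and> odd (c div 2 ^ (k - 1)) then q else p)"

text \<open>
  Tree nodes are lists with the last step in front, so that \<open>tl\<close> is the parent: the node at
  depth \<open>k\<close> on the path for clause code \<open>c\<close> below vertex \<open>w\<close> is \<open>c, \<dots>, c, w\<close>.
\<close>

definition branch :: "nat \<Rightarrow> nat \<Rightarrow> nat \<Rightarrow> nat list" where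
  "branch c w k = (if k = 0 then [] else replicate (k - 1) c @ [w])"

definition tree_nodes :: "nat \<Rightarrow> nat list set" where
  "tree_nodes d = insert [] ((\<lambda>(k, e, b). branch (clause_code d e) (if b then fst e else snd e) (Suc k)) `
     ({..2 * d} \<times> cube d \<times> UNIV))"

text \<open>An edge is labelled through its lower end. At depth one \<open>hd x\<close> is a
  hypercube vertex instead of a clause code, which is harmless since level 0 has a constant
  label.\<close>

definition tree_graph :: "nat \<Rightarrow> 's \<Rightarrow> 's \<Rightarrow> (nat, 's) lgraph" where
  "tree_graph d p q = \<lparr>verts = to_nat ` tree_nodes d,
     edges = (\<lambda>x. (to_nat (tl x), to_nat x)) ` (tree_nodes d - {[]}),
     lab = (\<lambda>(a, b). let x = from_nat b :: nat list in level_label p q (hd x) (length x - 1))\<rparr>"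

text \<open>Each clause occupies a block of \<open>2 * h\<close> edges: \<open>h\<close> down, then
  \<open>h\<close> up with the same labels in reverse order. The smaller end of an edge gives its
  position, whichever way it points.\<close>

definition zigzag :: "nat \<Rightarrow> 's \<Rightarrow> 's \<Rightarrow> nat list \<Rightarrow> (nat, 's) lgraph" where
  "zigzag h p q cs = \<lparr>verts = {..2 * h * length cs},
     edges = (\<lambda>i. if i mod (2 * h) < h then (i, Suc i) else (Suc i, i)) ` {..<2 * h * length cs},
     lab = (\<lambda>(a, b). let i = min a b; r = i mod (2 * h) in
       level_label p q (cs ! (i div (2 * h))) (if r < h then r else 2 * h - 1 - r))\<rparr>"

lemma clause_code_less:
  assumes "e \<in> cube d"
  shows "clause_code d e < 2 ^ (2 * d)"
proof -
  obtain u v where e: "e = (u, v)" by force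
  then have "u < 2 ^ d" "v < 2 ^ d" using cube_subset assms by blast+
  then have "u + 2 ^ d * v < 2 ^ d * Suc v" by simp
  also have "\<dots> \<le> 2 ^ d * 2 ^ d" using \<open>v < 2 ^ d\<close> by (intro mult_le_mono2) simp
  finally show ?thesis by (simp add: e clause_code_def power_add mult_2)
qed

lemma clause_code_inj: "inj_on (clause_code d) (cube d)"
proof (rule inj_onI)
  fix e e' assume *: "e \<in> cube d" "e' \<in> cube d" "clause_code d e = clause_code d e'"
  then have "fst e < 2 ^ d" "fst e' < 2 ^ d" using cube_subset by fastforce+
  then have "clause_code d e mod 2 ^ d = fst e" "clause_code d e div 2 ^ d = snd e"
    "clause_code d e' mod 2 ^ d = fst e'" "clause_code d e' div 2 ^ d = snd e'"
    by (simp_all add: clause_code_def)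
  with *(3) show "e = e'" by (metis prod_eq_iff)
qed

text \<open>Levels 1 to \<open>m\<close> spell the low \<open>m\<close> bits, and all higher bits
  vanish below \<open>2 ^ m\<close>.\<close>

lemma eq_if_level_labels_eq:
  assumes "p \<noteq> q" "c < 2 ^ m" "c' < 2 ^ m"
    and "\<And>k. k < m \<Longrightarrow> level_label p q c (Suc k) = level_label p q c' (Suc k)"
  shows "c = c'"
proof (rule bit_eqI)
  fix k
  show "bit c k = bit c' k"
  proof (cases "k < m")
    case True
    then show ?thesis
      using assms(1) assms(4)[OF True] by (auto simp: level_label_def bit_iff_odd split: if_splits)
  next
    case False
    then have "(2::nat) ^ m \<le> 2 ^ k" by simp
    then have "c < 2 ^ k" "c' < 2 ^ k" using assms(2,3) by linarith+
    then show ?thesis by (simp add: bit_iff_odd)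
  qed
qed

lemma tl_branch: "tl (branch c w (Suc k)) = branch c w k"
  by (cases k) (auto simp: branch_def)

lemma length_branch: "length (branch c w k) = k"
  by (simp add: branch_def)

lemma branch_0: "branch c w 0 = []" and branch_1: "branch c w (Suc 0) = [w]"
  by (simp_all add: branch_def)

lemma hd_branch: "hd (branch c w (Suc (Suc k))) = c"
  by (simp add: branch_def)

lemma level_label_branch:
  "level_label p q (hd (branch c w (Suc k))) (length (branch c w (Suc k)) - 1) = level_label p q c k"
  by (cases k) (simp_all add: hd_branch length_branch level_label_def)

lemma tree_nodesE:
  assumes "x \<in> tree_nodes d" "x \<noteq> []"
  obtains k e w where "k \<le> 2 * d" "e \<in> cube d" "w = fst e \<or> w = snd e"
    "x = branch (clause_code d e) w (Suc k)"
  using assms unfolding tree_nodes_def by (fastforce split: if_splits)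

lemma branch_in_tree_nodes:
  assumes "k \<le> Suc (2 * d)" "e \<in> cube d" "w = fst e \<or> w = snd e"
  shows "branch (clause_code d e) w k \<in> tree_nodes d"
proof (cases k)
  case (Suc j)
  have "branch (clause_code d e) w k =
    (\<lambda>(k, e, b). branch (clause_code d e) (if b then fst e else snd e) (Suc k)) (j, e, w = fst e)"
    using assms(3) by (auto simp: Suc)
  then show ?thesis
    using assms(1,2) Suc unfolding tree_nodes_def by blast
qed (simp add: branch_0 tree_nodes_def)

lemma Nil_in_tree_nodes: "[] \<in> tree_nodes d"
  by (simp add: tree_nodes_def)

lemma tl_in_tree_nodes:
  assumes "x \<in> tree_nodes d"
  shows "tl x \<in> tree_nodes d"
proof (cases "x = []")
  case False
  then obtain k e w where "k \<le> 2 * d" "e \<in> cube d" "w = fst e \<or> w = snd e"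
    "x = branch (clause_code d e) w (Suc k)"
    using tree_nodesE assms by blast
  then show ?thesis
    by (simp add: tl_branch branch_in_tree_nodes)
qed (use assms in simp)

lemma length_tree_nodes: "x \<in> tree_nodes d \<Longrightarrow> length x \<le> Suc (2 * d)"
  by (cases "x = []") (auto elim!: tree_nodesE simp: length_branch)

lemma finite_tree_nodes: "finite (tree_nodes d)"
  unfolding tree_nodes_def using finite_cube by simp

lemma singleton_in_tree_nodes:
  assumes "v < 2 ^ d" "d > 0"
  shows "[v] \<in> tree_nodes d"
proof -
  obtain u where "(u, v) \<in> cube d \<or> (v, u) \<in> cube d"
    using cube_neighbour_exists[OF assms] .
  then show ?thesis
    using branch_in_tree_nodes[of 1 d "(u, v)" v] branch_in_tree_nodes[of 1 d "(v, u)" v]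
    by (auto simp: branch_1)
qed

section \<open>The tree instance: shape and size\<close>

lemma tree_graph_over:
  assumes "p \<in> \<sigma>" "q \<in> \<sigma>"
  shows "graph_over \<sigma> (tree_graph d p q)"
proof -
  have "tree_nodes d \<noteq> {}" using Nil_in_tree_nodes by blast
  then show ?thesis
    using assms finite_tree_nodes tl_in_tree_nodes
    by (auto simp: graph_over_def tree_graph_def level_label_def Let_def split: if_splits)
qed

lemma tree_graph_downward: "downward_tree (tree_graph d p q)"
proof -
  let ?H = "tree_graph d p q"
  have "(to_nat ([] :: nat list), to_nat x) \<in> (edges ?H)\<^sup>*" if "x \<in> tree_nodes d" for x
    using that
  proof (induction x)
    case (Cons a x)
    have "(to_nat x, to_nat (a # x)) \<in> edges ?H"
      using Cons.prems by (force simp: tree_graph_def image_iff)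
    moreover have "x \<in> tree_nodes d"
      using tl_in_tree_nodes[OF Cons.prems] by simp
    ultimately show ?case
      using Cons.IH by (meson rtrancl_into_rtrancl)
  qed simp
  then show ?thesis
    unfolding downward_tree_def
    by (intro bexI[of _ "to_nat ([] :: nat list)"] conjI)
      (auto simp: tree_graph_def Nil_in_tree_nodes)
qed

lemma graph_size_tree_graph_le: "graph_size (tree_graph d p q) \<le> 2 * Suc (2 * d) * (d * 2 ^ d)"
proof -
  have "graph_size (tree_graph d p q) \<le> card (tree_nodes d - {[]})"
    unfolding graph_size_def tree_graph_def using finite_tree_nodes by (simp add: card_image_le)
  also have "\<dots> \<le> card ((\<lambda>(k, e, b). branch (clause_code d e) (if b then fst e else snd e) (Suc k)) `
     ({..2 * d} \<times> cube d \<times> (UNIV :: bool set)))"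
    using finite_cube by (intro card_mono) (auto simp: tree_nodes_def)
  also have "\<dots> \<le> card ({..2 * d} \<times> cube d \<times> (UNIV :: bool set))"
    using finite_cube by (intro card_image_le) auto
  also have "\<dots> = 2 * Suc (2 * d) * card (cube d)"
    by (simp add: card_cartesian_product)
  also have "\<dots> \<le> 2 * Suc (2 * d) * (d * 2 ^ d)"
    by (intro mult_le_mono2 card_cube_le)
  finally show ?thesis .
qed

text \<open>The edges at the root alone suffice, since every hypercube vertex lies in some
  clause.\<close>

lemma graph_size_tree_graph_ge:
  assumes "d > 0"
  shows "2 ^ d \<le> graph_size (tree_graph d p q)"
proof -
  have "(\<lambda>v. (to_nat ([] :: nat list), to_nat [v])) ` {..<(2::nat) ^ d} \<subseteq> edges (tree_graph d p q)"
  proof (rule image_subsetI)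
    fix v :: nat assume "v \<in> {..<2 ^ d}"
    then have "[v] \<in> tree_nodes d - {[]}" using singleton_in_tree_nodes assms by simp
    then have "(to_nat (tl [v]), to_nat [v]) \<in> edges (tree_graph d p q)"
      unfolding tree_graph_def lgraph.simps by (rule imageI)
    then show "(to_nat ([] :: nat list), to_nat [v]) \<in> edges (tree_graph d p q)" by simp
  qed
  moreover have "inj_on (\<lambda>v. (to_nat ([] :: nat list), to_nat [v])) {..<(2::nat) ^ d}"
    by (auto simp: inj_on_def)
  moreover have "finite (edges (tree_graph d p q))"
    using finite_tree_nodes by (simp add: tree_graph_def)
  ultimately show ?thesis
    using card_inj_on_le[of _ "{..<(2::nat) ^ d}" "edges (tree_graph d p q)"]
    by (fastforce simp: graph_size_def)
qed

section \<open>The path query, and its provenance on the tree\<close>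

lemma zigzag_over:
  assumes "p \<in> \<sigma>" "q \<in> \<sigma>"
  shows "graph_over \<sigma> (zigzag h p q cs)"
  using assms by (auto simp: graph_over_def zigzag_def level_label_def Let_def)

lemma zigzag_two_way_path: "two_way_path (zigzag h p q cs)"
proof -
  let ?as = "[0..<Suc (2 * h * length cs)]"
  let ?fwd = "\<lambda>i. i mod (2 * h) < h"
  have "edges (zigzag h p q cs) =
    {if ?fwd i then (?as ! i, ?as ! Suc i) else (?as ! Suc i, ?as ! i) | i. Suc i < length ?as}"
    (is "_ = {?e i | i. _}")
  proof -
    have "?e i = (if ?fwd i then (i, Suc i) else (Suc i, i))" if "i < 2 * h * length cs" for i
      using that nth_upt[of 0 i "Suc (2 * h * length cs)"] nth_upt[of 0 "Suc i" "Suc (2 * h * length cs)"]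
      by (simp del: upt_Suc)
    then have "edges (zigzag h p q cs) = ?e ` {..<2 * h * length cs}"
      unfolding zigzag_def lgraph.simps by (intro image_cong) simp_all
    also have "\<dots> = {?e i | i. Suc i < length ?as}"
      by (simp del: upt_Suc add: setcompr_eq_image lessThan_def)
    finally show ?thesis .
  qed
  moreover have "verts (zigzag h p q cs) = set ?as"
    by (auto simp: zigzag_def)
  ultimately show ?thesis
    unfolding two_way_path_def
    by (intro exI[of _ ?as] exI[of _ ?fwd]) (simp del: upt_Suc)
qed

lemma graph_size_zigzag_le: "graph_size (zigzag h p q cs) \<le> 2 * h * length cs"
  unfolding graph_size_def zigzag_def lgraph.simps
  by (rule card_image_le[THEN order_trans]) simp_all

text \<open>Forward, a descent as long as the tree is high runs from the root to a leaf, and its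
  labels identify the clause, so the root edge it uses belongs to an end of that clause. Backward,
  each block walks down and up below a chosen true end; blocks begin and end at the root and hence
  fit together.\<close>

lemma Prov_zigzag_tree:
  assumes "p \<noteq> q" and cs: "set cs = clause_code d ` cube d"
    and \<nu>: "\<And>x. x \<notin> (\<lambda>v. (to_nat ([] :: nat list), to_nat [v])) ` {..<(2::nat) ^ d} \<Longrightarrow> \<nu> x"
  shows "Prov (zigzag (Suc (2 * d)) p q cs) (tree_graph d p q) \<nu> \<longleftrightarrow>
    (\<forall>(u, v) \<in> cube d. \<nu> (to_nat ([] :: nat list), to_nat [u]) \<or> \<nu> (to_nat ([] :: nat list), to_nat [v]))"
    (is "Prov ?G ?H \<nu> \<longleftrightarrow> ?sat")
proof
  define h where "h = Suc (2 * d)"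
  let ?P = "2 * h"
  let ?K = "?P * length cs"
  let ?root = "to_nat ([] :: nat list)"
  assume "Prov ?G ?H \<nu>"
  then obtain f where f: "is_hom ?G (restrict_graph ?H \<nu>) f"
    unfolding Prov_def has_hom_def by blast
  show ?sat
  proof clarify
    fix u v assume uv: "(u, v) \<in> cube d" and not_v: "\<not> \<nu> (?root, to_nat [v])"
    define c where "c = clause_code d (u, v)"
    then have "c \<in> set cs" using uv cs by auto
    then obtain b where b: "b < length cs" "cs ! b = c"
      by (metis in_set_conv_nth)
    \<comment> \<open>The images of the vertices on the descending half of block
      \<open>b\<close>.\<close>
    define x where "x k = (from_nat (f (b * ?P + k)) :: nat list)" for k
    have step: "x k = tl (x (Suc k))" "x (Suc k) \<in> tree_nodes d" "x (Suc k) \<noteq> []"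
      "level_label p q (hd (x (Suc k))) (length (x (Suc k)) - 1) = level_label p q c k"
      "\<nu> (to_nat (x k), to_nat (x (Suc k)))" if k: "k < h" for k
    proof -
      let ?i = "b * ?P + k"
      have "?i < Suc b * ?P" using k by simp
      also have "\<dots> \<le> length cs * ?P" using b by (intro mult_le_mono1) simp
      finally have i: "?i < ?K" by (simp add: mult.commute)
      have m: "?i mod ?P = k" "?i div ?P = b" using k by simp_all
      have "(?i, Suc ?i) \<in> edges ?G"
        using i m k unfolding zigzag_def h_def[symmetric] by (force simp: image_iff)
      then have e: "(f ?i, f (Suc ?i)) \<in> edges (restrict_graph ?H \<nu>)"
        "lab (restrict_graph ?H \<nu>) (f ?i, f (Suc ?i)) = lab ?G (?i, Suc ?i)"
        using f unfolding is_hom_def by blast+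
      from e(1) obtain y where y: "y \<in> tree_nodes d" "y \<noteq> []" "f ?i = to_nat (tl y)"
        "f (Suc ?i) = to_nat y" "\<nu> (f ?i, f (Suc ?i))"
      proof -
        have "(f ?i, f (Suc ?i)) \<in> (\<lambda>x. (to_nat (tl x), to_nat x)) ` (tree_nodes d - {[]})"
          "\<nu> (f ?i, f (Suc ?i))"
          using e(1) by (simp_all add: restrict_graph_def tree_graph_def)
        then show ?thesis using that by blast
      qed
      then have xy: "x k = tl y" "x (Suc k) = y" by (simp_all add: x_def)
      have "lab ?G (?i, Suc ?i) = level_label p q c k"
        using m k b unfolding zigzag_def h_def[symmetric] by (simp add: Let_def)
      then show "x k = tl (x (Suc k))" "x (Suc k) \<in> tree_nodes d" "x (Suc k) \<noteq> []"
        "level_label p q (hd (x (Suc k))) (length (x (Suc k)) - 1) = level_label p q c k"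
        "\<nu> (to_nat (x k), to_nat (x (Suc k)))"
        using y e(2) xy by (simp_all add: restrict_graph_def tree_graph_def)
    qed
    have len: "length (x k) = length (x 0) + k" if "k \<le> h" for k
      using that
    proof (induction k)
      case (Suc k)
      then have "length (x k) = length (x (Suc k)) - 1" "x (Suc k) \<noteq> []"
        using step(1)[of k] step(3)[of k] by simp_all
      then show ?case using Suc by (cases "x (Suc k)") auto
    qed simp
    \<comment> \<open>No node is deeper than \<open>h\<close>, and \<open>h\<close> steps down were
      made, so the descent began at the root.\<close>
    have xh: "x h \<in> tree_nodes d" "x h \<noteq> []"
      using step(2,3)[of "2 * d"] by (simp_all add: h_def)
    then have len0: "length (x 0) = 0" "length (x h) = h"
      using length_tree_nodes[OF xh(1)] len[of h] by (simp_all add: h_def)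
    obtain k e w where e: "e \<in> cube d" "w = fst e \<or> w = snd e"
      and xk: "x h = branch (clause_code d e) w (Suc k)"
      using tree_nodesE[OF xh] by metis
    then have "Suc k = h" using len0(2) by (simp add: length_branch)
    with xk have xb: "x h = branch (clause_code d e) w h" by simp
    have down: "x (h - m) = branch (clause_code d e) w (h - m)" if "m \<le> h" for m
      using that
    proof (induction m)
      case (Suc m)
      then have "Suc (h - Suc m) = h - m" by simp
      then show ?case
        using Suc step(1)[of "h - Suc m"] tl_branch[of "clause_code d e" w "h - Suc m"] by simp
    qed (simp add: xb)
    have xs: "x k = branch (clause_code d e) w k" if "k \<le> h" for k
      using down[of "h - k"] that by simp
    have "c = clause_code d e"
    proof (rule eq_if_level_labels_eq[OF \<open>p \<noteq> q\<close>])
      show "c < 2 ^ (2 * d)" "clause_code d e < 2 ^ (2 * d)"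
        using clause_code_less uv e(1) by (simp_all add: c_def)
      fix k assume "k < 2 * d"
      then have "Suc k < h" by (simp add: h_def)
      then show "level_label p q c (Suc k) = level_label p q (clause_code d e) (Suc k)"
        using step(4)[of "Suc k"] xs[of "Suc (Suc k)"] level_label_branch[of p q "clause_code d e" w "Suc k"]
        by simp
    qed
    then have "e = (u, v)"
      using inj_onD[OF clause_code_inj] uv e(1) unfolding c_def by metis
    moreover have "\<nu> (?root, to_nat [w])"
      using step(5)[of 0] xs[of 0] xs[of 1] by (simp add: branch_0 branch_1 h_def)
    ultimately show "\<nu> (?root, to_nat [u])" using e(2) not_v by auto
  qed
next
  define h where "h = Suc (2 * d)"
  let ?P = "2 * h"
  let ?K = "?P * length cs"
  let ?root = "to_nat ([] :: nat list)"
  let ?Hr = "restrict_graph ?H \<nu>"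
  assume sat: ?sat
  have "\<exists>w. \<exists>e \<in> cube d. (w = fst e \<or> w = snd e) \<and> cs ! b = clause_code d e \<and> \<nu> (?root, to_nat [w])"
    if "b < length cs" for b
  proof -
    have "cs ! b \<in> clause_code d ` cube d" using that cs nth_mem by blast
    then show ?thesis using sat by fastforce
  qed
  then obtain w where w: "\<And>b. b < length cs \<Longrightarrow>
    \<exists>e \<in> cube d. (w b = fst e \<or> w b = snd e) \<and> cs ! b = clause_code d e \<and> \<nu> (?root, to_nat [w b])"
    by metis
  define node where "node b k = branch (cs ! b) (w b) k" for b k
  have node_in: "node b k \<in> tree_nodes d" if "b < length cs" "k \<le> h" for b k
    using w[OF that(1)] that(2) branch_in_tree_nodes unfolding node_def h_def by metis
  have edge: "(to_nat (node b k), to_nat (node b (Suc k))) \<in> edges ?Hr"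
    "lab ?Hr (to_nat (node b k), to_nat (node b (Suc k))) = level_label p q (cs ! b) k"
    if b: "b < length cs" and k: "k < h" for b k
  proof -
    have "\<nu> (to_nat (node b k), to_nat (node b (Suc k)))"
    proof (cases k)
      case 0
      then show ?thesis using w[OF b] by (auto simp: node_def branch_0 branch_1)
    next
      case (Suc j)
      have "node b k \<noteq> []" using Suc length_branch[of "cs ! b" "w b" k] by (auto simp: node_def)
      then show ?thesis by (intro \<nu>) auto
    qed
    moreover have "node b (Suc k) \<in> tree_nodes d - {[]}" "tl (node b (Suc k)) = node b k"
      using node_in[OF b, of "Suc k"] k by (auto simp: node_def tl_branch branch_def)
    ultimately show "(to_nat (node b k), to_nat (node b (Suc k))) \<in> edges ?Hr"
      unfolding restrict_graph_def tree_graph_def by (force simp: image_iff)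
    show "lab ?Hr (to_nat (node b k), to_nat (node b (Suc k))) = level_label p q (cs ! b) k"
      using level_label_branch[of p q "cs ! b" "w b" k]
      by (simp add: restrict_graph_def tree_graph_def node_def)
  qed
  \<comment> \<open>In the second half of a block the depth is mirrored to \<open>2 * h\<close>
    minus the position.\<close>
  define f where "f i = to_nat (node (i div ?P) (if i mod ?P < h then i mod ?P else ?P - i mod ?P))" for i
  have div_less: "i div ?P < length cs" if "i < ?K" for i
    using that by (simp add: less_mult_imp_div_less mult.commute)
  have "is_hom ?G ?Hr f"
    unfolding is_hom_def
  proof (intro conjI allI impI)
    show "f ` verts ?G \<subseteq> verts ?Hr"
    proof (rule image_subsetI)
      fix i assume "i \<in> verts ?G"
      then have "i < ?K \<or> i = ?K" by (auto simp: zigzag_def h_def)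
      then have "node (i div ?P) (if i mod ?P < h then i mod ?P else ?P - i mod ?P) \<in> tree_nodes d"
      proof
        assume "i < ?K"
        then show ?thesis by (intro node_in div_less) auto
      next
        \<comment> \<open>The last vertex has block index \<open>length cs\<close>, out of range for
          \<open>cs\<close>, but at depth 0 the branch is the root for any code.\<close>
        assume "i = ?K"
        then have "i mod ?P = 0" by simp
        moreover have "0 < h" by (simp add: h_def)
        ultimately show ?thesis by (simp add: node_def branch_0 Nil_in_tree_nodes)
      qed
      then show "f i \<in> verts ?Hr"
        by (simp add: f_def restrict_graph_def tree_graph_def)
    qed
    fix a b assume "(a, b) \<in> edges ?G"
    then obtain i where i: "i < ?K" "(a, b) = (if i mod ?P < h then (i, Suc i) else (Suc i, i))"
      unfolding zigzag_def h_def[symmetric] by auto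
    define r where "r = i mod ?P"
    have r: "r < ?P" by (simp add: r_def h_def)
    let ?b = "i div ?P"
    have "(f a, f b) \<in> edges ?Hr \<and> lab ?Hr (f a, f b) = lab ?G (a, b)"
    proof (cases "r < h")
      case True
      then have ab: "a = i" "b = Suc i" using i(2) by (simp_all add: r_def)
      have "Suc i mod ?P = Suc r" "Suc i div ?P = ?b"
        using True by (auto simp: mod_Suc div_Suc r_def h_def)
      then have "f (Suc i) = to_nat (node ?b (Suc r))"
        using True by (cases "Suc r < h") (auto simp: f_def intro!: arg_cong[where f = "node _"])
      moreover have "f i = to_nat (node ?b r)"
        using True by (simp add: f_def flip: r_def)
      moreover have "lab ?G (i, Suc i) = level_label p q (cs ! ?b) r"
        using True unfolding zigzag_def h_def[symmetric] by (simp add: Let_def flip: r_def)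
      ultimately show ?thesis
        using edge[OF div_less[OF i(1)] True] ab by simp
    next
      case False
      then have ab: "a = Suc i" "b = i" using i(2) by (simp_all add: r_def)
      \<comment> \<open>The depth of the upper end of the tree edge climbed at this step.\<close>
      define k where "k = ?P - 1 - r"
      have k: "k < h" "Suc k = ?P - r" using False r by (simp_all add: k_def)
      have "f (Suc i) = to_nat (node ?b k)"
      proof (cases "Suc r = ?P")
        case True
        then have "Suc i mod ?P = 0" "k = 0" by (simp_all add: mod_Suc r_def k_def)
        then show ?thesis by (simp add: f_def node_def branch_0 h_def)
      next
        case ne: False
        then have "Suc i mod ?P = Suc r" "Suc i div ?P = ?b"
          by (auto simp: mod_Suc div_Suc r_def)
        then show ?thesis
          using False by (simp add: f_def k_def)
      qed
      moreover have "f i = to_nat (node ?b (Suc k))"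
        using False k(2) by (simp add: f_def flip: r_def)
      moreover have "lab ?G (Suc i, i) = level_label p q (cs ! ?b) k"
        using False unfolding zigzag_def h_def[symmetric] by (simp add: Let_def k_def flip: r_def)
      ultimately show ?thesis
        using edge[OF div_less[OF i(1)] k(1)] ab by simp
    qed
    then show "(f a, f b) \<in> edges ?Hr" "lab ?Hr (f a, f b) = lab ?G (a, b)"
      by simp_all
  qed
  then show "Prov ?G ?H \<nu>"
    unfolding Prov_def has_hom_def by blast
qed

subsection \<open>The lower bound\<close>

text \<open>The left side is a polynomial in \<open>d\<close> times
  \<open>2 powr ((1 - \<delta>) * d)\<close>, hence negligible against \<open>2 ^ d\<close>. Its
  inner factor bounds the total size, and \<open>12 * (d + 1) ^ 4\<close> is the denominator in the
  circuit bound.\<close>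

lemma exponent_bound:
  assumes "0 < \<delta>"
  obtains B :: real where "0 < B"
    "\<And>d::nat. 12 * (real d + 1) ^ 4 * (12 * (real d + 1)\<^sup>2 * 2 ^ d) powr (1 - \<delta>) \<le> B * 2 ^ d"
proof -
  let ?f = "\<lambda>d::nat. 12 * (real d + 1) ^ 4 * (12 * (real d + 1)\<^sup>2 * 2 ^ d) powr (1 - \<delta>) / 2 ^ d"
  have "?f \<longlonglongrightarrow> 0"
    using assms by real_asymp
  then have "Bseq ?f"
    using convergentI convergent_imp_Bseq by blast
  then obtain B where B: "0 < B" "\<And>d. norm (?f d) \<le> B"
    by (auto elim: BseqE)
  show ?thesis
  proof (rule that[OF B(1)])
    fix d :: nat
    have "?f d \<le> B" using B(2)[of d] by (simp add: abs_le_iff)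
    then show "12 * (real d + 1) ^ 4 * (12 * (real d + 1)\<^sup>2 * 2 ^ d) powr (1 - \<delta>) \<le> B * 2 ^ d"
      by (simp add: divide_le_eq)
  qed
qed

theorem proposition5p3:
  fixes \<sigma> :: "'s set" and \<epsilon> :: real
  assumes "finite \<sigma>" and "card \<sigma> \<ge> 2" and "\<epsilon> > 0"
  shows "\<exists>(G :: nat \<Rightarrow> (nat, 's) lgraph) (H :: nat \<Rightarrow> (nat, 's) lgraph).
    (\<forall>i>0. graph_over \<sigma> (G i) \<and> two_way_path (G i)) \<and>
    (\<forall>i>0. graph_over \<sigma> (H i) \<and> downward_tree (H i)) \<and>
    (\<forall>N. \<exists>i>0. graph_size (G i) + graph_size (H i) > N) \<and>
    (\<exists>c>0. \<forall>i>0. \<forall>C :: (nat, nat \<times> nat) circuit.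
       DNNF (edges (H i)) C \<and> circuit_computes C (Prov (G i) (H i)) \<longrightarrow>
       real (circuit_size C) \<ge>
         2 powr (c * real (graph_size (G i) + graph_size (H i)) powr (1 - \<epsilon>)))"
proof -
  obtain p q where pq: "p \<in> \<sigma>" "q \<in> \<sigma>" "p \<noteq> q"
    using assms(1,2) card_le_Suc0_iff_eq[of \<sigma>] by auto
  have "\<exists>cs. set cs = clause_code d ` cube d \<and> length cs \<le> card (cube d)" for d
    using finite_distinct_list[OF finite_imageI[OF finite_cube]]
    by (metis card_image_le distinct_card finite_cube)
  then obtain cs where cs: "\<And>d. set (cs d) = clause_code d ` cube d" "\<And>d. length (cs d) \<le> card (cube d)"
    by metis
  define G where "G d = zigzag (Suc (2 * d)) p q (cs d)" for d
  define H where "H d = tree_graph d p q" for d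
  let ?size = "\<lambda>d. graph_size (G d) + graph_size (H d)"
  have size_ge: "2 ^ d \<le> ?size d" if "d > 0" for d
    using graph_size_tree_graph_ge[OF that, of p q] by (simp add: H_def)
  have size_le: "real (?size d) \<le> 12 * (real d + 1)\<^sup>2 * 2 ^ d" for d
  proof -
    have "length (cs d) \<le> d * 2 ^ d" using cs(2) card_cube_le by (rule order_trans)
    then have "2 * Suc (2 * d) * length (cs d) \<le> 2 * Suc (2 * d) * (d * 2 ^ d)"
      by (rule mult_le_mono2)
    then have "?size d \<le> 4 * Suc (2 * d) * d * 2 ^ d"
      using graph_size_zigzag_le[of "Suc (2 * d)" p q "cs d"] graph_size_tree_graph_le[of d p q]
      unfolding G_def H_def by linarith
    also have "\<dots> \<le> 12 * (d + 1)\<^sup>2 * 2 ^ d"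
      by (simp add: power2_eq_square algebra_simps)
    finally have "real (?size d) \<le> real (12 * (d + 1)\<^sup>2 * 2 ^ d)"
      by (rule of_nat_mono)
    then show ?thesis by (simp add: add.commute)
  qed
  \<comment> \<open>Capping at 1/2 keeps \<open>1 - \<delta>\<close> positive, so that
    \<open>powr\<close> is monotone in the size. Sizes are at least 1, so the bound with
    \<open>\<delta>\<close> implies the one with \<open>\<epsilon>\<close>.\<close>
  define \<delta> where "\<delta> = min \<epsilon> (1 / 2)"
  have \<delta>: "0 < \<delta>" "\<delta> \<le> \<epsilon>" "\<delta> < 1" using assms(3) by (auto simp: \<delta>_def)
  obtain B where B: "0 < B"
    "\<And>d::nat. 12 * (real d + 1) ^ 4 * (12 * (real d + 1)\<^sup>2 * 2 ^ d) powr (1 - \<delta>) \<le> B * 2 ^ d"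
    using exponent_bound[OF \<delta>(1)] by blast
  have lower: "2 powr (1 / B * real (?size d) powr (1 - \<epsilon>)) \<le> real (circuit_size C)"
    if d: "d > 0" and C: "DNNF (edges (H d)) C" "circuit_computes C (Prov (G d) (H d))"
    for d and C :: "(nat, nat \<times> nat) circuit"
  proof -
    have "(1::nat) \<le> 2 ^ d" by simp
    then have "1 \<le> real (?size d)" using size_ge[OF d] by linarith
    then have "real (?size d) powr (1 - \<epsilon>) \<le> real (?size d) powr (1 - \<delta>)"
      using \<delta> by (intro powr_mono) auto
    also have "\<dots> \<le> (12 * (real d + 1)\<^sup>2 * 2 ^ d) powr (1 - \<delta>)"
      using size_le \<delta> by (intro powr_mono2) auto
    also have "\<dots> \<le> B * 2 ^ d / (12 * (real d + 1) ^ 4)"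
    proof -
      have "0 < 12 * (real d + 1) ^ 4" by simp
      then show ?thesis using B(2)[of d] by (simp only: pos_le_divide_eq mult.commute)
    qed
    finally have "1 / B * real (?size d) powr (1 - \<epsilon>) \<le> 2 ^ d / (12 * (real d + 1) ^ 4)"
      using B(1) by (simp add: pos_divide_le_eq mult.commute)
    then have "2 powr (1 / B * real (?size d) powr (1 - \<epsilon>)) \<le> 2 powr (2 ^ d / (12 * (real d + 1) ^ 4))"
      by (intro powr_mono) auto
    also have "\<dots> \<le> real (circuit_size C)"
    proof (rule DNNF_cube_vertex_cover[OF d C])
      show "inj_on (\<lambda>v. (to_nat ([] :: nat list), to_nat [v])) {..<(2::nat) ^ d}"
        by (auto simp: inj_on_def)
      show "Prov (G d) (H d) \<nu> \<longleftrightarrow>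
          (\<forall>(u, v) \<in> cube d. \<nu> (to_nat ([] :: nat list), to_nat [u]) \<or> \<nu> (to_nat ([] :: nat list), to_nat [v]))"
        if "\<And>x. x \<notin> (\<lambda>v. (to_nat ([] :: nat list), to_nat [v])) ` {..<(2::nat) ^ d} \<Longrightarrow> \<nu> x" for \<nu>
        unfolding G_def H_def using that by (rule Prov_zigzag_tree[OF pq(3) cs(1)])
    qed
    finally show ?thesis .
  qed
  have "\<forall>i>0. graph_over \<sigma> (G i) \<and> two_way_path (G i)"
    unfolding G_def by (intro allI impI conjI zigzag_over zigzag_two_way_path pq)
  moreover have "\<forall>i>0. graph_over \<sigma> (H i) \<and> downward_tree (H i)"
    unfolding H_def by (intro allI impI conjI tree_graph_over tree_graph_downward pq)
  moreover have "\<forall>N. \<exists>i>0. ?size i > N"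
  proof
    fix N :: nat
    have "N < 2 ^ Suc N" using less_exp[of "Suc N"] by linarith
    also have "\<dots> \<le> ?size (Suc N)" by (rule size_ge) simp
    finally show "\<exists>i>0. ?size i > N" by blast
  qed
  moreover have "\<exists>c>0. \<forall>i>0. \<forall>C :: (nat, nat \<times> nat) circuit.
      DNNF (edges (H i)) C \<and> circuit_computes C (Prov (G i) (H i)) \<longrightarrow>
      real (circuit_size C) \<ge> 2 powr (c * real (?size i) powr (1 - \<epsilon>))"
  proof (intro exI conjI allI impI)
    show "0 < 1 / B" using B(1) by simp
  qed (elim conjE, rule lower)
  ultimately show ?thesis
    by (intro exI[of _ G] exI[of _ H] conjI)
qed

end
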